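(* Let $p$ be a prime, let $R$ be a commutative ring with $1$ of characteristic $p$, and let $n\ge k\ge 1$ be integers. (a) Let $f$ and $g$ be elements of $\mathcal{N}(R)$ such that $D(f)\ge k$ and $D(gf^{-1})\ge n$. Then $$D(g^pf^{-p})\ge n+(p-1)k+e(k,n).$$ (b) There exist $f,g\in\mathcal{N}(R)$ such that $D(f)=k$, $D(gf^{-1})=n$, and $$D(g^pf^{-p})=n+(p-1)k+e(k,n).$$
   Context: For a commutative ring $R$ with $1$ of characteristic $p$, the Nottingham group $\mathcal{N}=\mathcal{N}(R)$ is the set of all formal power series $f(x)\in R[[x]]$ with leading term $x$ (i.e. $f(x)=x+a_1x^2+a_2x^3+\cdots$), with product $(fg)(x)=f(g(x))$; powers and inverses are taken in this group. For $k\ge1$ put $\mathcal{N}_k=\{f\in\mathcal{N}: f(x)\equiv x \pmod{x^{k+1}}\}$. The depth of $f\in\mathcal{N}$ is $D(f)=\sup\{k: f\in\mathcal{N}_k\}$ (so $D(x)=\infty$). For $n\ge k\ge1$ let $k_0$ be the least nonnegative residue of $k$ modulo $p$, and define the nonnegative integer $e(k,n)$ by: - $e(k,n)=0$ if $p\mid k$ and $n=k$; - $e(k,n)=1$ if $p\mid k$, $p\mid n$ and $n>k$; - $e(k,n)=0$ if $p\mid k$ and $p\nmid n$; - $e(k,n)=i$ if $p\nmid k$ and $n\equiv 2k-i \pmod p$ for some $0\le i\le k_0$; - $e(k,n)=k_0$ if $p\nmid k$ and $n\not\equiv 2k-i\pmod p$ for all $0\le i\le k_0$. *)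

theory Defs
  imports
    "HOL-Algebra.Group"
    "HOL-Computational_Algebra.Formal_Power_Series"
    "HOL-Computational_Algebra.Primes"
    "HOL-Number_Theory.Cong"
    "HOL-Library.Extended_Nat"
begin

definition nottingham :: "'a::comm_ring_1 fps monoid" where
  "nottingham =
    \<lparr>carrier = {f. fps_nth f 0 = 0 \<and> fps_nth f 1 = 1}, monoid.mult = fps_compose, one = fps_X\<rparr>"

definition nottingham_level :: "nat \<Rightarrow> 'a::comm_ring_1 fps set" where
  "nottingham_level k = {f \<in> carrier nottingham. fps_X ^ (k + 1) dvd f - fps_X}"

definition depth :: "'a::comm_ring_1 fps \<Rightarrow> enat" where
  "depth f = Sup {enat k | k. k \<ge> 1 \<and> f \<in> nottingham_level k}"

(* Only meant for n >= k >= 1 and p prime. The i chosen by THE is unique because k mod p < p;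
   the congruence is taken in the integers since 2 k - i may be truncated in nat. *)
definition depth_excess :: "nat \<Rightarrow> nat \<Rightarrow> nat \<Rightarrow> nat" where
  "depth_excess p k n =
    (if p dvd k then (if p dvd n \<and> n > k then 1 else 0)
     else if \<exists>i\<le>k mod p. [int n = 2 * int k - int i] (mod int p)
       then (THE i. i \<le> k mod p \<and> [int n = 2 * int k - int i] (mod int p))
     else k mod p)"

end

theory Submission
  imports Defs "HOL-Number_Theory.Residues"
begin

text \<open>Write \<open>f = X + \<phi>\<close> with \<open>\<phi>\<close> of order at least \<open>k + 1\<close>, and let \<open>T\<close> be the substitution
operator \<open>u \<mapsto> u oo f\<close>. In characteristic \<open>p\<close> one has \<open>(T - 1)\<^sup>p = T\<^sup>p - 1\<close>, so the compositional
power satisfies \<open>f\<^sup>p - X = (T - 1)\<^sup>p X\<close>. Now \<open>T - 1\<close> agrees to first order with the vector field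
\<open>D = \<phi> d/dX\<close>; if \<open>g - f\<close> has order at least \<open>n + 1\<close>, replacing \<open>T - 1\<close> by \<open>D\<close> for both series
changes no coefficient of \<open>g\<^sup>p - f\<^sup>p\<close> up to degree \<open>n + p k\<close>
(\<open>difference_funpow_vfield_funpow_compare\<close>).

For a vector field in characteristic \<open>p\<close> there is a closed formula, essentially due to Hochschild:
\<open>D\<^sup>p X = - \<phi> \<partial>\<^sup>p\<^sup>-\<^sup>1(\<phi>\<^sup>p\<^sup>-\<^sup>1)\<close> (\<open>vfield_funpow_prime_X\<close>). The operator \<open>\<partial>\<^sup>p\<^sup>-\<^sup>1\<close> only retains the
monomials whose exponent is \<open>-1\<close> modulo \<open>p\<close>, and this is the origin of all the congruences. Passing
from \<open>f\<close> to \<open>g\<close> changes \<open>D\<^sup>p X\<close> by two kinds of terms. Those in which the outer factor \<open>\<phi>\<close> changes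
start \<open>k mod p\<close> degrees later than expected, since \<open>\<phi>\<^sup>p\<^sup>-\<^sup>1\<close> has order at least \<open>(p - 1)(k + 1)\<close>. Those in
which \<open>\<phi>\<^sup>p\<^sup>-\<^sup>1\<close> changes start \<open>i\<close> degrees later, where \<open>i\<close> is the residue of \<open>2 k - n\<close>. Hence
\<open>g\<^sup>p - f\<^sup>p\<close> has order greater than \<open>n + (p - 1) k + min i (k mod p)\<close>, which is the claim when \<open>p\<close> does
not divide \<open>k\<close>. When \<open>p\<close> divides \<open>k\<close>, neither kind need be delayed if also \<open>p\<close> divides \<open>n\<close>, but for
\<open>n > k\<close> their leading terms then cancel, which gains one degree.

For sharpness, the coefficient of \<open>g\<^sup>p - f\<^sup>p\<close> in degree \<open>n + (p - 1) k + 1\<close> is computed for \<open>k < n\<close>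
in \<open>leading_coeff_power_prime_diff\<close>; it is a unit for suitable \<open>f\<close> and \<open>g\<close> whenever the excess is \<open>0\<close>.
The case \<open>n = k\<close> with \<open>p\<close> dividing \<open>k\<close> is settled by \<open>g = X\<close>.
If the excess \<open>e\<close> is positive but this coefficient does not vanish for \<open>n + e\<close> in place of \<open>n\<close>, fix
\<open>g = X + X\<^sup>k\<^sup>+\<^sup>1 - X\<^sup>n\<^sup>+\<^sup>1\<close>; adding \<open>X\<^sup>n\<^sup>+\<^sup>e\<^sup>+\<^sup>1\<close> to \<open>f = X + X\<^sup>k\<^sup>+\<^sup>1\<close> shifts the critical coefficient of
\<open>g\<^sup>p - f\<^sup>p\<close> by a unit, so \<open>f\<close> itself or the modified series is sharp
(\<open>ex_sharp_pair_below\<close>). In the remaining case let \<open>g\<close> be the conjugate of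
\<open>f\<close> by \<open>X + X\<^sup>n\<^sup>-\<^sup>k\<^sup>+\<^sup>1\<close>. Then \<open>g\<^sup>p\<close> is the same conjugate of \<open>f\<^sup>p\<close>, and both differences are commutators whose
leading terms are visible (\<open>ex_sharp_pair_conjugate\<close>).\<close>

unbundle fps_syntax

section \<open>Power series modulo powers of \<open>X\<close>\<close>


lemma X_power_dvd_iff:
  fixes u :: "'a::comm_ring_1 fps"
  shows "fps_X ^ m dvd u \<longleftrightarrow> (\<forall>i<m. u $ i = 0)"
proof
  assume "fps_X ^ m dvd u"
  then show "\<forall>i<m. u $ i = 0"
    by (auto elim!: dvdE simp: fps_X_power_mult_nth)
next
  assume "\<forall>i<m. u $ i = 0"
  then have "u = fps_X ^ m * fps_shift m u"
    by (auto simp: fps_eq_iff fps_X_power_mult_nth)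
  then show "fps_X ^ m dvd u"
    by (rule dvdI)
qed

lemma X_power_dvd_le:
  fixes u :: "'a::comm_ring_1 fps"
  shows "fps_X ^ m dvd u \<Longrightarrow> n \<le> m \<Longrightarrow> fps_X ^ n dvd u"
  by (simp add: X_power_dvd_iff)

lemma X_power_Suc_dvd_iff:
  fixes u :: "'a::comm_ring_1 fps"
  shows "fps_X ^ Suc m dvd u \<longleftrightarrow> fps_X ^ m dvd u \<and> u $ m = 0"
  unfolding X_power_dvd_iff by (auto simp: less_Suc_eq)

lemma X_power_dvd_mult:
  fixes u v :: "'a::comm_ring_1 fps"
  assumes "fps_X ^ a dvd u" "fps_X ^ b dvd v" "c \<le> a + b"
  shows "fps_X ^ c dvd u * v"
  using mult_dvd_mono[OF assms(1,2)] assms(3) by (auto simp flip: power_add intro: X_power_dvd_le)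

lemma leading_coeff_mult:
  fixes u v :: "'a::comm_ring_1 fps"
  assumes "fps_X ^ a dvd u" "fps_X ^ b dvd v"
  shows "(u * v) $ (a + b) = u $ a * v $ b"
proof -
  obtain u' v' where "u = fps_X ^ a * u'" "v = fps_X ^ b * v'"
    using assms by (auto elim!: dvdE)
  moreover have "fps_X ^ a * u' * (fps_X ^ b * v') = fps_X ^ (a + b) * (u' * v')"
    by (simp add: power_add mult_ac)
  ultimately show ?thesis
    by (simp add: fps_X_power_mult_nth)
qed

lemma X_power_dvd_deriv:
  fixes u :: "'a::comm_ring_1 fps"
  assumes "fps_X ^ m dvd u" "n \<le> m - 1"
  shows "fps_X ^ n dvd fps_deriv u"
  using assms by (auto simp: X_power_dvd_iff)

lemma X_power_dvd_mult_deriv: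
  fixes u h :: "'a::comm_ring_1 fps"
  assumes "fps_X ^ Suc d dvd h" "fps_X ^ m dvd u" "c \<le> m + d"
  shows "fps_X ^ c dvd h * fps_deriv u"
proof (rule X_power_dvd_mult[OF assms(1)])
  show "fps_X ^ (m - 1) dvd fps_deriv u"
    using assms(2) by (rule X_power_dvd_deriv) simp
qed (use assms in simp)

lemma X_power_dvd_power:
  fixes u :: "'a::comm_ring_1 fps"
  assumes "fps_X ^ a dvd u"
  shows "fps_X ^ (i * a) dvd u ^ i"
proof (induction i)
  case (Suc i)
  then show ?case
    using X_power_dvd_mult[OF assms Suc, of "Suc i * a"] by simp
qed simp

lemma power_diff_dvd:
  fixes f g :: "'a::comm_ring_1 fps"
  assumes "fps_X ^ a dvd f" "fps_X ^ a dvd g" "fps_X ^ b dvd g - f"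
  shows "fps_X ^ (b + i * a) dvd g ^ Suc i - f ^ Suc i"
proof (induction i)
  case (Suc i)
  have f: "fps_X ^ (Suc i * a) dvd f ^ Suc i"
    using assms(1) by (rule X_power_dvd_power)
  have "g ^ Suc (Suc i) - f ^ Suc (Suc i) = g * (g ^ Suc i - f ^ Suc i) + (g - f) * f ^ Suc i"
    by (simp add: algebra_simps)
  moreover have "fps_X ^ (b + Suc i * a) dvd g * (g ^ Suc i - f ^ Suc i)"
    using X_power_dvd_mult[OF assms(2) Suc] by simp
  moreover have "fps_X ^ (b + Suc i * a) dvd (g - f) * f ^ Suc i"
    using X_power_dvd_mult[OF assms(3) f] by simp
  ultimately show ?case
    by simp
qed (use assms in simp)

lemma leading_coeff_power:
  fixes f :: "'a::comm_ring_1 fps"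
  assumes "fps_X ^ a dvd f"
  shows "f ^ i $ (i * a) = (f $ a) ^ i"
proof (induction i)
  case (Suc i)
  have f: "fps_X ^ (i * a) dvd f ^ i"
    using assms by (rule X_power_dvd_power)
  show ?case
    using leading_coeff_mult[OF assms f] Suc by simp
qed simp

lemma leading_coeff_power_diff:
  fixes f g :: "'a::comm_ring_1 fps"
  assumes "fps_X ^ a dvd f" "fps_X ^ a dvd g" "fps_X ^ b dvd g - f" "a < b"
  shows "(g ^ Suc i - f ^ Suc i) $ (b + i * a) = of_nat (Suc i) * (g - f) $ b * (f $ a) ^ i"
proof (induction i)
  case (Suc i)
  have f: "fps_X ^ (Suc i * a) dvd f ^ Suc i"
    using assms(1) by (rule X_power_dvd_power)
  have "g $ a = f $ a"
    using assms(3,4) by (auto simp: X_power_dvd_iff)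
  have "g ^ Suc (Suc i) - f ^ Suc (Suc i) = g * (g ^ Suc i - f ^ Suc i) + (g - f) * f ^ Suc i"
    by (simp add: algebra_simps)
  moreover have "(g * (g ^ Suc i - f ^ Suc i)) $ (b + Suc i * a)
      = f $ a * (of_nat (Suc i) * (g - f) $ b * (f $ a) ^ i)"
    using leading_coeff_mult[OF assms(2) power_diff_dvd[OF assms(1-3), of i]]
    by (simp only: Suc \<open>g $ a = f $ a\<close> add.left_commute[of a b] mult_Suc)
  moreover have "((g - f) * f ^ Suc i) $ (b + Suc i * a) = (g - f) $ b * (f $ a) ^ Suc i"
    using leading_coeff_mult[OF assms(3) f] leading_coeff_power[OF assms(1), of "Suc i"]
    by (simp only:)
  ultimately have "(g ^ Suc (Suc i) - f ^ Suc (Suc i)) $ (b + Suc i * a)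
      = f $ a * (of_nat (Suc i) * (g - f) $ b * (f $ a) ^ i) + (g - f) $ b * (f $ a) ^ Suc i"
    by (simp only: fps_add_nth)
  also have "\<dots> = of_nat (Suc (Suc i)) * (g - f) $ b * (f $ a) ^ Suc i"
    by (simp add: algebra_simps)
  finally show ?case .
qed simp

section \<open>Composition and the Nottingham group\<close>

lemma compose_nth_le:
  fixes a c :: "'a::comm_ring_1 fps"
  assumes "c $ 0 = 0" "n \<le> N"
  shows "(a oo c) $ n = (\<Sum>i\<le>N. a $ i * c ^ i $ n)"
  unfolding fps_compose_nth atLeast0AtMost
  using assms by (intro sum.mono_neutral_left) (auto simp: startsby_zero_power_prefix)

text \<open>In degree \<open>n\<close> only the first \<open>n + 1\<close> coefficients of \<open>a\<close> and \<open>b\<close> matter, so both series may be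
replaced by polynomials in \<open>c\<close>, which are multiplied out.\<close>

lemma compose_mult:
  fixes a b c :: "'a::comm_ring_1 fps"
  assumes c: "c $ 0 = 0"
  shows "a * b oo c = (a oo c) * (b oo c)"
proof (rule fps_ext)
  fix n
  let ?t = "\<lambda>i j. a $ i * b $ j * c ^ (i + j) $ n"
  define A where "A = (\<Sum>i\<le>n. fps_const (a $ i) * c ^ i)"
  define B where "B = (\<Sum>i\<le>n. fps_const (b $ i) * c ^ i)"
  have A: "(a oo c) $ m = A $ m" and B: "(b oo c) $ m = B $ m" if "m \<le> n" for m
    using that by (simp_all add: A_def B_def fps_sum_nth compose_nth_le[OF c])
  have "((a oo c) * (b oo c)) $ n = (A * B) $ n"
    by (simp add: fps_mult_nth A B)
  also have "A * B = (\<Sum>i\<le>n. \<Sum>j\<le>n. fps_const (a $ i * b $ j) * c ^ (i + j))"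
    by (simp add: A_def B_def sum_product power_add mult_ac flip: fps_const_mult)
  also have "\<dots> $ n = (\<Sum>i\<le>n. \<Sum>j\<le>n. ?t i j)"
    by (simp add: fps_sum_nth)
  also have "\<dots> = (\<Sum>i\<le>n. \<Sum>j\<le>n - i. ?t i j)"
  proof (rule sum.cong[OF refl], rule sum.mono_neutral_right)
    fix i
    have "c ^ (i + j) $ n = 0" if "\<not> j \<le> n - i" for j
      using that startsby_zero_power_prefix[OF c, of "i + j"] by simp
    then show "\<forall>j\<in>{..n} - {..n - i}. ?t i j = 0"
      by simp
  qed auto
  also have "\<dots> = (\<Sum>(i, j)\<in>{(i, j). i + j \<le> n}. ?t i j)"
  proof -
    have "(SIGMA i:{..n}. {..n - i}) = {(i, j). i + j \<le> n}"
      by auto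
    then show ?thesis
      by (simp add: sum.Sigma)
  qed
  also have "\<dots> = (\<Sum>k\<le>n. \<Sum>i\<le>k. ?t i (k - i))"
    by (rule sum.triangle_reindex_eq)
  also have "\<dots> = (a * b oo c) $ n"
    by (simp add: fps_compose_nth fps_mult_nth atLeast0AtMost sum_distrib_right)
  finally show "(a * b oo c) $ n = ((a oo c) * (b oo c)) $ n"
    by simp
qed

lemma compose_power:
  fixes a c :: "'a::comm_ring_1 fps"
  assumes "c $ 0 = 0"
  shows "a ^ i oo c = (a oo c) ^ i"
  by (induction i) (simp_all add: compose_mult[OF assms])

lemma compose_assoc:
  fixes a b c :: "'a::comm_ring_1 fps"
  assumes b: "b $ 0 = 0" and c: "c $ 0 = 0"
  shows "a oo (b oo c) = (a oo b) oo c"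
proof (rule fps_ext)
  fix n
  have "(a oo (b oo c)) $ n = (\<Sum>i\<le>n. \<Sum>j\<le>n. a $ i * (b ^ i $ j * c ^ j $ n))"
    by (simp add: compose_nth_le[of _ n n] b c sum_distrib_left flip: compose_power)
  also have "\<dots> = (\<Sum>j\<le>n. \<Sum>i\<le>n. a $ i * (b ^ i $ j * c ^ j $ n))"
    by (rule sum.swap)
  also have "\<dots> = ((a oo b) oo c) $ n"
    by (simp add: compose_nth_le[of c n n] compose_nth_le[of b _ n] b c sum_distrib_right mult.assoc)
  finally show "(a oo (b oo c)) $ n = ((a oo b) oo c) $ n" .
qed

lemma X_power_dvd_compose:
  fixes u f :: "'a::comm_ring_1 fps"
  assumes "fps_X ^ m dvd u" "f $ 0 = 0"
  shows "fps_X ^ m dvd u oo f"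
proof -
  obtain w where u: "u = fps_X ^ m * w"
    using assms by (auto elim: dvdE)
  have "fps_X ^ 1 dvd f"
    using assms unfolding X_power_dvd_iff by simp
  then show ?thesis
    unfolding u by (simp add: assms compose_mult compose_power dvd_power_same)
qed

text \<open>The first coefficient that \<open>X ^ m dvd u\<close> leaves open is not changed by a substitution tangent to the
identity.\<close>

lemma leading_coeff_compose:
  fixes u f :: "'a::comm_ring_1 fps"
  assumes "fps_X ^ m dvd u" "f $ 0 = 0" "f $ 1 = 1"
  shows "(u oo f) $ m = u $ m"
proof -
  have "(u oo f) $ m = (\<Sum>i\<in>{m}. u $ i * f ^ i $ m)"
    unfolding fps_compose_nth
    using assms by (intro sum.mono_neutral_right) (auto simp: X_power_dvd_iff)
  also have "\<dots> = u $ m"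
    using assms by (simp add: startsby_zero_power_nth_same)
  finally show ?thesis .
qed

text \<open>The coefficients of the left inverse solve a triangular system whose diagonal entries are the
\<open>n\<close>th coefficients of \<open>f ^ n\<close>, all equal to \<open>1\<close>; so they can be found recursively over any
commutative ring.\<close>

lemma ex_left_compinv:
  fixes f :: "'a::comm_ring_1 fps"
  assumes f: "f $ 0 = 0" "f $ 1 = 1"
  obtains a where "a $ 0 = 0" "a $ 1 = 1" "a oo f = fps_X"
proof -
  obtain A :: "nat \<Rightarrow> 'a" where A: "A n = fps_X $ n - (\<Sum>i<n. A i * f ^ i $ n)" for n
  proof -
    define A where "A = wfrec less_than (\<lambda>A n. fps_X $ n - (\<Sum>i<n. A i * f ^ i $ n))"
    have "A n = fps_X $ n - (\<Sum>i<n. A i * f ^ i $ n)" for n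
      unfolding A_def by (subst wfrec) (auto simp: cut_def intro!: sum.cong)
    then show thesis by (rule that)
  qed
  define a where "a = Abs_fps A"
  have 1: "a oo f = fps_X"
  proof (rule fps_ext)
    fix n
    have "(a oo f) $ n = (\<Sum>i<n. A i * f ^ i $ n) + A n * f ^ n $ n"
      by (simp add: a_def fps_compose_nth atLeast0AtMost flip: lessThan_Suc_atMost)
    also have "f ^ n $ n = 1"
      using f by (simp add: startsby_zero_power_nth_same)
    finally show "(a oo f) $ n = fps_X $ n"
      by (simp add: A[of n])
  qed
  moreover have "a $ 0 = 0"
    by (simp add: a_def A[of 0])
  moreover have "a $ 1 = 1"
    using A[of 1] \<open>a $ 0 = 0\<close> by (simp add: a_def)
  ultimately show thesis
    using that by blast
qed

lemma nottingham_carrier_iff: "f \<in> carrier nottingham \<longleftrightarrow> f $ 0 = 0 \<and> f $ 1 = 1"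
  by (simp add: nottingham_def)

lemma nottingham_mult [simp]: "f \<otimes>\<^bsub>nottingham\<^esub> g = f oo g"
  by (simp add: nottingham_def)

lemma nottingham_one [simp]: "\<one>\<^bsub>nottingham\<^esub> = fps_X"
  by (simp add: nottingham_def)

lemma group_nottingham: "group (nottingham :: 'a::comm_ring_1 fps monoid)"
proof (rule groupI)
  fix f g :: "'a fps"
  assume "f \<in> carrier nottingham" "g \<in> carrier nottingham"
  then show "f \<otimes>\<^bsub>nottingham\<^esub> g \<in> carrier nottingham"
    using leading_coeff_compose[of 1 f g]
    unfolding nottingham_carrier_iff X_power_dvd_iff by simp
next
  fix f :: "'a fps"
  assume "f \<in> carrier nottingham"
  then show "\<exists>g\<in>carrier nottingham. g \<otimes>\<^bsub>nottingham\<^esub> f = \<one>\<^bsub>nottingham\<^esub>"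
    using ex_left_compinv[of f] unfolding nottingham_carrier_iff nottingham_mult nottingham_one Bex_def
    by metis
qed (auto simp: nottingham_carrier_iff compose_assoc)

lemma nottingham_power_eq_funpow:
  fixes f :: "'a::comm_ring_1 fps"
  shows "f [^]\<^bsub>nottingham\<^esub> (i :: nat) = ((\<lambda>u. u oo f) ^^ i) fps_X"
  by (induction i) simp_all

lemma nottingham_level_iff:
  assumes "f \<in> carrier nottingham"
  shows "f \<in> nottingham_level m \<longleftrightarrow> fps_X ^ Suc m dvd f - fps_X"
  using assms by (simp add: nottingham_level_def del: power_Suc)

lemma depth_ge_iff:
  fixes f :: "'a::comm_ring_1 fps"
  assumes f: "f \<in> carrier nottingham" and m: "m \<ge> 1"
  shows "depth f \<ge> enat m \<longleftrightarrow> fps_X ^ Suc m dvd f - fps_X"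
proof
  assume *: "depth f \<ge> enat m"
  show "fps_X ^ Suc m dvd f - fps_X"
  proof (rule ccontr)
    assume n: "\<not> ?thesis"
    have "x \<le> enat (m - 1)" if x: "x \<in> {enat k |k. k \<ge> 1 \<and> f \<in> nottingham_level k}" for x
    proof -
      obtain k where k: "x = enat k" "fps_X ^ Suc k dvd f - fps_X"
        using x unfolding mem_Collect_eq nottingham_level_iff[OF f] by blast
      then have "\<not> m \<le> k"
        using n X_power_dvd_le[OF k(2), of "Suc m"] by blast
      then show ?thesis
        using k by simp
    qed
    then have "depth f \<le> enat (m - 1)"
      unfolding depth_def by (rule Sup_least)
    then have "enat m \<le> enat (m - 1)"
      using * order_trans by blast
    then show False
      using m by simp
  qed
next
  assume "fps_X ^ Suc m dvd f - fps_X"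
  then show "depth f \<ge> enat m"
    unfolding depth_def using f m by (intro Sup_upper) (auto simp: nottingham_level_iff simp del: power_Suc)
qed

lemma depth_eq_iff:
  fixes f :: "'a::comm_ring_1 fps"
  assumes f: "f \<in> carrier nottingham" and m: "m \<ge> 1"
  shows "depth f = enat m \<longleftrightarrow> fps_X ^ Suc m dvd f - fps_X \<and> (f - fps_X) $ Suc m \<noteq> 0"
proof -
  have "depth f = enat m \<longleftrightarrow> depth f \<ge> enat m \<and> \<not> depth f \<ge> enat (Suc m)"
    by (cases "depth f") auto
  then show ?thesis
    using depth_ge_iff[OF assms] depth_ge_iff[OF f, of "Suc m"] X_power_Suc_dvd_iff[of "Suc m" "f - fps_X"]
    by auto
qed

text \<open>Substituting \<open>f\<close> or its inverse turns \<open>g \<circ> f\<^sup>-\<^sup>1 - X\<close> and \<open>g - f\<close> into each other. Depths of quotients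
thus become statements about ordinary differences, and inverses disappear from the argument.\<close>

lemma quotient_minus_X:
  fixes f g :: "'a::comm_ring_1 fps"
  assumes "f \<in> carrier nottingham" "g \<in> carrier nottingham"
  defines "h \<equiv> g \<otimes>\<^bsub>nottingham\<^esub> inv\<^bsub>nottingham\<^esub> f"
  shows "h \<in> carrier nottingham"
    and "fps_X ^ m dvd h - fps_X \<longleftrightarrow> fps_X ^ m dvd g - f"
    and "fps_X ^ m dvd g - f \<Longrightarrow> (h - fps_X) $ m = (g - f) $ m"
proof -
  interpret group "nottingham :: 'a fps monoid"
    by (rule group_nottingham)
  let ?i = "inv\<^bsub>nottingham\<^esub> f"
  have i: "?i \<in> carrier nottingham"
    using assms by simp
  then have i01: "?i $ 0 = 0" "?i $ 1 = 1"
    by (auto simp: nottingham_carrier_iff)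
  have f01: "f $ 0 = 0"
    using assms by (auto simp: nottingham_carrier_iff)
  show "h \<in> carrier nottingham"
    unfolding h_def using assms i by (intro m_closed)
  have "f oo ?i = fps_X" "?i oo f = fps_X"
    using r_inv[OF assms(1)] l_inv[OF assms(1)] by simp_all
  then have 1: "h - fps_X = (g - f) oo ?i" and "g - f = (h - fps_X) oo f"
    by (simp_all add: h_def fps_compose_sub_distrib f01 i01 flip: compose_assoc)
  then show "fps_X ^ m dvd h - fps_X \<longleftrightarrow> fps_X ^ m dvd g - f"
    using X_power_dvd_compose[OF _ f01] X_power_dvd_compose[OF _ i01(1)] by metis
  show "(h - fps_X) $ m = (g - f) $ m" if "fps_X ^ m dvd g - f"
    unfolding 1 using that i01 by (rule leading_coeff_compose)
qed

lemma depth_quotient_ge_iff: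
  fixes f g :: "'a::comm_ring_1 fps"
  assumes "f \<in> carrier nottingham" "g \<in> carrier nottingham" "m \<ge> 1"
  shows "depth (g \<otimes>\<^bsub>nottingham\<^esub> inv\<^bsub>nottingham\<^esub> f) \<ge> enat m \<longleftrightarrow> fps_X ^ Suc m dvd g - f"
  unfolding depth_ge_iff[OF quotient_minus_X(1)[OF assms(1,2)] assms(3)]
  by (rule quotient_minus_X(2)[OF assms(1,2)])

lemma depth_quotient_eq_iff:
  fixes f g :: "'a::comm_ring_1 fps"
  assumes "f \<in> carrier nottingham" "g \<in> carrier nottingham" "m \<ge> 1"
  shows "depth (g \<otimes>\<^bsub>nottingham\<^esub> inv\<^bsub>nottingham\<^esub> f) = enat m
    \<longleftrightarrow> fps_X ^ Suc m dvd g - f \<and> (g - f) $ Suc m \<noteq> 0"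
  using quotient_minus_X(2,3)[OF assms(1,2), of "Suc m"]
  unfolding depth_eq_iff[OF quotient_minus_X(1)[OF assms(1,2)] assms(3)] by auto

section \<open>Substitution operators and vector fields\<close>

text \<open>A linear operator that respects the \<open>X\<close>-adic filtration need only be examined on monomials: modulo
\<open>X ^ (m + d)\<close>, a series divisible by \<open>X ^ m\<close> is a finite combination of them.\<close>

lemma linear_operator_filtration:
  fixes L :: "'a::comm_ring_1 fps \<Rightarrow> 'a fps"
  assumes add: "\<And>u v. L (u + v) = L u + L v"
    and scale: "\<And>c u. L (fps_const c * u) = fps_const c * L u"
    and cont: "\<And>M u. fps_X ^ M dvd u \<Longrightarrow> fps_X ^ M dvd L u"
    and mono: "\<And>i. m \<le> i \<Longrightarrow> fps_X ^ (i + d) dvd L (fps_X ^ i)"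
    and u: "fps_X ^ m dvd u"
  shows "fps_X ^ (m + d) dvd L u"
proof -
  define s where "s j = (\<Sum>i<j. fps_const (u $ i) * fps_X ^ i)" for j
  have s: "fps_X ^ (m + d) dvd L (s j)" for j
  proof (induction j)
    case 0
    then show ?case
      using scale[of 0 0] by (simp add: s_def)
  next
    case (Suc j)
    have "fps_X ^ (m + d) dvd fps_const (u $ j) * L (fps_X ^ j)"
    proof (cases "j < m")
      case True
      then show ?thesis
        using u by (simp add: X_power_dvd_iff)
    next
      case False
      then have "fps_X ^ (m + d) dvd L (fps_X ^ j)"
        using X_power_dvd_le[OF mono[of j], of "m + d"] by simp
      then show ?thesis
        by (rule dvd_mult)
    qed
    then show ?case
      using Suc by (simp add: s_def add scale)
  qed
  have "s (m + d) $ i = u $ i" if "i < m + d" for i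
    using that by (simp add: s_def fps_sum_nth fps_X_power_nth mult_delta_right)
  then have "fps_X ^ (m + d) dvd u - s (m + d)"
    by (simp add: X_power_dvd_iff)
  then have "fps_X ^ (m + d) dvd L (s (m + d)) + L (u - s (m + d))"
    by (intro dvd_add s cont)
  then show ?thesis
    using add[of "s (m + d)" "u - s (m + d)"] by simp
qed

lemma nth_0_eq_0_of_dvd_minus_X:
  fixes f :: "'a::comm_ring_1 fps"
  assumes "fps_X ^ Suc k dvd f - fps_X"
  shows "f $ 0 = 0"
  using assms unfolding X_power_dvd_iff by (auto dest: spec[of _ 0])

lemma taylor_power:
  fixes f g :: "'a::comm_ring_1 fps"
  assumes f: "fps_X ^ Suc k dvd f - fps_X" and g: "fps_X ^ Suc k dvd g - fps_X"
    and fg: "fps_X ^ Suc n dvd g - f"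
  shows "fps_X ^ (i + (n + k)) dvd g ^ i - f ^ i - (g - f) * fps_deriv (fps_X ^ i)"
proof (induction i)
  case (Suc i)
  have f1: "fps_X ^ 1 dvd f" and g1: "fps_X ^ 1 dvd g"
    using nth_0_eq_0_of_dvd_minus_X[OF f] nth_0_eq_0_of_dvd_minus_X[OF g] unfolding X_power_dvd_iff by simp_all
  let ?N = "Suc i + (n + k)"
  let ?E = "\<lambda>i. g ^ i - f ^ i - (g - f) * fps_deriv (fps_X ^ i)"
  have "?E (Suc i) = g * ?E i + (g - f) * ((g - fps_X) * fps_deriv (fps_X ^ i)) + (g - f) * (f ^ i - fps_X ^ i)"
    by (simp add: algebra_simps)
  moreover have "fps_X ^ ?N dvd g * ?E i"
    by (rule X_power_dvd_mult[OF g1 Suc]) simp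
  moreover have "fps_X ^ ?N dvd (g - f) * ((g - fps_X) * fps_deriv (fps_X ^ i))"
  proof (rule X_power_dvd_mult[OF fg])
    show "fps_X ^ (i + k) dvd (g - fps_X) * fps_deriv (fps_X ^ i)"
      by (rule X_power_dvd_mult_deriv[OF g]) auto
  qed simp
  moreover have "fps_X ^ ?N dvd (g - f) * (f ^ i - fps_X ^ i)"
  proof (rule X_power_dvd_mult[OF fg])
    show "fps_X ^ (i + k) dvd f ^ i - fps_X ^ i"
    proof (cases i)
      case (Suc j)
      then show ?thesis
        using power_diff_dvd[OF _ f1 f, of j] by (simp add: add_ac)
    qed simp
  qed simp
  ultimately show ?case
    by (simp only: dvd_add)
qed simp

text \<open>First-order Taylor expansion: the linear term \<open>(g - f) u'\<close> has order \<open>m + n\<close>, and the order of the error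
is larger by another \<open>k\<close> because \<open>f\<close> and \<open>g\<close> are themselves that close to \<open>X\<close>.\<close>

lemma taylor_compose:
  fixes f g u :: "'a::comm_ring_1 fps"
  assumes f: "fps_X ^ Suc k dvd f - fps_X" and g: "fps_X ^ Suc k dvd g - fps_X"
    and fg: "fps_X ^ Suc n dvd g - f" and u: "fps_X ^ m dvd u"
  shows "fps_X ^ (m + (n + k)) dvd (u oo g) - (u oo f) - (g - f) * fps_deriv u"
proof (rule linear_operator_filtration[where L = "\<lambda>u. (u oo g) - (u oo f) - (g - f) * fps_deriv u"])
  have f0: "f $ 0 = 0" and g0: "g $ 0 = 0"
    using f g by (blast intro: nth_0_eq_0_of_dvd_minus_X)+
  show "fps_X ^ M dvd (u oo g) - (u oo f) - (g - f) * fps_deriv u" if "fps_X ^ M dvd u" for M u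
    using that by (intro dvd_diff X_power_dvd_compose f0 g0 X_power_dvd_mult_deriv[OF fg]) auto
  show "fps_X ^ (i + (n + k)) dvd (fps_X ^ i oo g) - (fps_X ^ i oo f) - (g - f) * fps_deriv (fps_X ^ i)" for i
    using taylor_power[OF f g fg, of i] by (simp add: compose_power f0 g0 del: fps_deriv_power)
qed (simp_all add: u fps_compose_add_distrib distrib_left right_diff_distrib mult.left_commute
    flip: fps_const_mult_apply_left)

definition difference :: "'a::comm_ring_1 fps \<Rightarrow> 'a fps \<Rightarrow> 'a fps" where
  "difference f u = (u oo f) - u"

definition vfield :: "'a::comm_ring_1 fps \<Rightarrow> 'a fps \<Rightarrow> 'a fps" where
  "vfield h u = h * fps_deriv u"

lemma vfield_funpow_0 [simp]: "(vfield h ^^ r) 0 = 0"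
  by (induction r) (simp_all add: vfield_def)

lemma difference_minus_vfield_dvd:
  fixes f u :: "'a::comm_ring_1 fps"
  assumes f: "fps_X ^ Suc k dvd f - fps_X" and u: "fps_X ^ m dvd u"
  shows "fps_X ^ (m + 2 * k) dvd difference f u - vfield (f - fps_X) u"
  using taylor_compose[of k fps_X f k m u] assms
  by (simp add: difference_def vfield_def mult_2)

lemma vfield_dvd:
  fixes h u :: "'a::comm_ring_1 fps"
  assumes "fps_X ^ Suc d dvd h" "fps_X ^ m dvd u"
  shows "fps_X ^ (m + d) dvd vfield h u"
  unfolding vfield_def by (rule X_power_dvd_mult_deriv[OF assms]) simp

lemma difference_dvd:
  fixes f u :: "'a::comm_ring_1 fps"
  assumes f: "fps_X ^ Suc k dvd f - fps_X" and u: "fps_X ^ m dvd u"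
  shows "fps_X ^ (m + k) dvd difference f u"
proof -
  have "fps_X ^ (m + k) dvd difference f u - vfield (f - fps_X) u"
    by (rule X_power_dvd_le[OF difference_minus_vfield_dvd[OF assms]]) simp
  from dvd_add[OF this vfield_dvd[OF assms]] show ?thesis
    by simp
qed

lemma difference_funpow_dvd:
  fixes f :: "'a::comm_ring_1 fps"
  assumes f: "fps_X ^ Suc k dvd f - fps_X"
  shows "fps_X ^ Suc (j * k) dvd (difference f ^^ j) fps_X"
proof (induction j)
  case (Suc j)
  from difference_dvd[OF f Suc] show ?case
    by (simp add: add_ac)
qed simp

lemma difference_funpow_minus_vfield_funpow_dvd:
  fixes f :: "'a::comm_ring_1 fps"
  assumes f: "fps_X ^ Suc k dvd f - fps_X"
  shows "fps_X ^ Suc (j * k + k) dvd (difference f ^^ j) fps_X - (vfield (f - fps_X) ^^ j) fps_X"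
proof (induction j)
  case (Suc j)
  let ?u = "(difference f ^^ j) fps_X" and ?u' = "(vfield (f - fps_X) ^^ j) fps_X"
  have "difference f ?u - vfield (f - fps_X) ?u'
      = (difference f ?u - vfield (f - fps_X) ?u) + vfield (f - fps_X) (?u - ?u')"
    by (simp add: vfield_def algebra_simps)
  moreover have "fps_X ^ Suc (Suc j * k + k) dvd difference f ?u - vfield (f - fps_X) ?u"
    using difference_minus_vfield_dvd[OF f difference_funpow_dvd[OF f, of j]] by (simp add: add_ac mult_2)
  moreover have "fps_X ^ Suc (Suc j * k + k) dvd vfield (f - fps_X) (?u - ?u')"
    using vfield_dvd[OF f Suc] by (simp add: add_ac)
  ultimately show ?case
    by (simp only: dvd_add funpow.simps o_apply)
qed simp

lemma difference_funpow_diff_dvd: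
  fixes f g :: "'a::comm_ring_1 fps"
  assumes f: "fps_X ^ Suc k dvd f - fps_X" and g: "fps_X ^ Suc k dvd g - fps_X"
    and fg: "fps_X ^ Suc (k + d) dvd g - f"
  shows "fps_X ^ Suc (j * k + d) dvd (difference g ^^ j) fps_X - (difference f ^^ j) fps_X"
proof (induction j)
  case (Suc j)
  let ?u = "(difference f ^^ j) fps_X" and ?v = "(difference g ^^ j) fps_X"
  have u: "fps_X ^ Suc (j * k) dvd ?u"
    by (rule difference_funpow_dvd[OF f])
  have "difference g ?v - difference f ?u = difference g (?v - ?u)
      + (((?u oo g) - (?u oo f) - (g - f) * fps_deriv ?u) + (g - f) * fps_deriv ?u)"
    by (simp add: difference_def fps_compose_sub_distrib)
  moreover have "fps_X ^ Suc (Suc j * k + d) dvd difference g (?v - ?u)"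
    using difference_dvd[OF g Suc] by (simp add: add_ac)
  moreover have "fps_X ^ Suc (Suc j * k + d) dvd (?u oo g) - (?u oo f) - (g - f) * fps_deriv ?u"
    by (rule X_power_dvd_le[OF taylor_compose[OF f g fg u]]) simp
  moreover have "fps_X ^ Suc (Suc j * k + d) dvd (g - f) * fps_deriv ?u"
    by (rule X_power_dvd_mult_deriv[OF fg u]) simp
  ultimately show ?case
    by (simp only: dvd_add funpow.simps o_apply)
qed (use fg in simp)

text \<open>All four iterates have order greater than \<open>j k\<close>. Replacing a difference operator by its vector field
changes them only \<open>k\<close> degrees further up, and passing from \<open>f\<close> to \<open>g\<close> only \<open>d\<close> degrees further up; in the
double difference both gains add up. This keeps all degrees up to \<open>n + p k\<close>, where \<open>n = k + d\<close>,
free of error.\<close>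

lemma difference_funpow_vfield_funpow_compare:
  fixes f g :: "'a::comm_ring_1 fps"
  assumes f: "fps_X ^ Suc k dvd f - fps_X" and g: "fps_X ^ Suc k dvd g - fps_X"
    and fg: "fps_X ^ Suc (k + d) dvd g - f"
  shows "fps_X ^ Suc (j * k + k + d) dvd
    ((difference g ^^ j) fps_X - (difference f ^^ j) fps_X)
    - ((vfield (g - fps_X) ^^ j) fps_X - (vfield (f - fps_X) ^^ j) fps_X)"
proof (induction j)
  case (Suc j)
  let ?u = "(difference f ^^ j) fps_X" and ?v = "(difference g ^^ j) fps_X"
  let ?u' = "(vfield (f - fps_X) ^^ j) fps_X" and ?v' = "(vfield (g - fps_X) ^^ j) fps_X"
  let ?N = "Suc (Suc j * k + k + d)"
  have "(difference g ?v - difference f ?u) - (vfield (g - fps_X) ?v' - vfield (f - fps_X) ?u')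
      = (difference g (?v - ?u) - vfield (g - fps_X) (?v - ?u))
        + (vfield (g - fps_X) ((?v - ?u) - (?v' - ?u'))
        + (((?u oo g) - (?u oo f) - (g - f) * fps_deriv ?u) + vfield (g - f) (?u - ?u')))"
    by (simp add: difference_def vfield_def fps_compose_sub_distrib algebra_simps)
  moreover have "fps_X ^ ?N dvd difference g (?v - ?u) - vfield (g - fps_X) (?v - ?u)"
    by (rule X_power_dvd_le[OF difference_minus_vfield_dvd[OF g difference_funpow_diff_dvd[OF f g fg]]]) simp
  moreover have "fps_X ^ ?N dvd vfield (g - fps_X) ((?v - ?u) - (?v' - ?u'))"
    using vfield_dvd[OF g Suc] by (simp add: add_ac)
  moreover have "fps_X ^ ?N dvd (?u oo g) - (?u oo f) - (g - f) * fps_deriv ?u"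
    by (rule X_power_dvd_le[OF taylor_compose[OF f g fg difference_funpow_dvd[OF f]]]) simp
  moreover have "fps_X ^ ?N dvd vfield (g - f) (?u - ?u')"
    by (rule X_power_dvd_le[OF vfield_dvd[OF fg difference_funpow_minus_vfield_funpow_dvd[OF f]]]) simp
  ultimately show ?case
    by (simp only: dvd_add funpow.simps o_apply)
qed simp

section \<open>Operators in characteristic p\<close>

text \<open>This is the binomial theorem without multiplication; it covers both the expansion of \<open>(T - 1)\<^sup>n\<close> for an
operator \<open>T\<close> and the Leibniz rule for \<open>d\<^sup>n (a b)\<close>.\<close>

lemma pascal_recursion:
  fixes F :: "nat \<Rightarrow> nat \<Rightarrow> nat \<Rightarrow> 'b::comm_ring_1"
  assumes "\<And>n i j. F (Suc n) i j = F n (Suc i) j + F n i (Suc j)"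
  shows "F n i j = (\<Sum>l\<le>n. of_nat (n choose l) * F 0 (i + l) (j + (n - l)))"
proof (induction n arbitrary: i j)
  case (Suc n)
  let ?t = "\<lambda>l. F 0 (i + l) (j + (Suc n - l))"
  have "(\<Sum>l\<le>n. of_nat (n choose l) * F 0 (i + l) (Suc j + (n - l))) = (\<Sum>l\<le>n. of_nat (n choose l) * ?t l)"
    by (intro sum.cong) (auto simp: Suc_diff_le)
  also have "\<dots> = (\<Sum>l\<le>Suc n. of_nat (n choose l) * ?t l)"
    by (simp add: binomial_eq_0)
  also have "\<dots> = ?t 0 + (\<Sum>l\<le>n. of_nat (n choose Suc l) * ?t (Suc l))"
    by (subst sum.atMost_Suc_shift) simp
  finally have "F (Suc n) i j = (\<Sum>l\<le>n. of_nat (n choose l) * ?t (Suc l))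
      + (?t 0 + (\<Sum>l\<le>n. of_nat (n choose Suc l) * ?t (Suc l)))"
    by (simp add: assms Suc)
  also have "\<dots> = ?t 0 + (\<Sum>l\<le>n. of_nat (Suc n choose Suc l) * ?t (Suc l))"
    by (simp add: sum.distrib distrib_right)
  also have "\<dots> = (\<Sum>l\<le>Suc n. of_nat (Suc n choose l) * ?t l)"
    by (subst sum.atMost_Suc_shift) simp
  finally show ?case .
qed simp

text \<open>The inner binomial coefficients vanish in characteristic \<open>p\<close>.\<close>

lemma pascal_recursion_prime:
  fixes F :: "nat \<Rightarrow> nat \<Rightarrow> nat \<Rightarrow> 'b::comm_ring_1"
  assumes p: "prime p" "CHAR('b) = p"
    and F: "\<And>n i j. F (Suc n) i j = F n (Suc i) j + F n i (Suc j)"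
  shows "F p 0 0 = F 0 p 0 + F 0 0 p"
proof -
  have "F p 0 0 = (\<Sum>l\<le>p. of_nat (p choose l) * F 0 l (p - l))"
    using pascal_recursion[where F = F, OF F, of p 0 0] by simp
  also have "\<dots> = (\<Sum>l\<in>{0, p}. of_nat (p choose l) * F 0 l (p - l))"
  proof (rule sum.mono_neutral_right)
    show "\<forall>l\<in>{..p} - {0, p}. of_nat (p choose l) * F 0 l (p - l) = 0"
    proof
      fix l assume "l \<in> {..p} - {0, p}"
      then have "p dvd p choose l"
        using p(1) by (intro dvd_choose_prime) auto
      then have "of_nat (p choose l) = (0 :: 'b)"
        using p(2) of_nat_eq_0_iff_char_dvd by blast
      then show "of_nat (p choose l) * F 0 l (p - l) = 0"
        by simp
    qed
  qed auto
  also have "\<dots> = F 0 p 0 + F 0 0 p"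
    using prime_gt_0_nat[OF p(1)] by (simp add: add.commute)
  finally show ?thesis .
qed

text \<open>All mixed terms of the Leibniz rule carry binomial coefficients divisible by \<open>p\<close>, so \<open>d\<^sup>p\<close> is again a
derivation.\<close>

lemma derivation_funpow_prime:
  fixes d :: "'b::comm_ring_1 \<Rightarrow> 'b"
  assumes p: "prime p" "CHAR('b) = p"
    and add: "\<And>a b. d (a + b) = d a + d b" and mult: "\<And>a b. d (a * b) = d a * b + a * d b"
  shows "(d ^^ p) (a * b) = (d ^^ p) a * b + a * (d ^^ p) b"
proof -
  have fadd: "(d ^^ n) (x + y) = (d ^^ n) x + (d ^^ n) y" for n x y
    by (induction n) (simp_all add: add)
  \<comment> \<open>Differentiating one factor or the other is the recursion for \<open>d\<^sup>n (d\<^sup>i a \<cdot> d\<^sup>j b)\<close>.\<close>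
  show ?thesis
    using pascal_recursion_prime[OF p, of "\<lambda>n i j. (d ^^ n) ((d ^^ i) a * (d ^^ j) b)"]
    by (simp add: fadd mult funpow_swap1)
qed

lemma difference_funpow_prime:
  fixes f :: "'a::comm_ring_1 fps"
  assumes p: "prime p" "CHAR('a) = p"
  shows "(difference f ^^ p) u = ((\<lambda>u. u oo f) ^^ p) u - u"
proof -
  let ?T = "\<lambda>u. u oo f"
  have comm: "(difference f ^^ n) ((?T ^^ j) u oo f) - (difference f ^^ n) ((?T ^^ j) u)
      = (difference f ^^ Suc n) ((?T ^^ j) u)" for n j
  proof -
    have "(difference f ^^ n) (x - y) = (difference f ^^ n) x - (difference f ^^ n) y" for x y
      by (induction n) (simp_all add: difference_def fps_compose_sub_distrib)
    then show ?thesis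
      by (simp only: funpow_Suc_right o_apply difference_def)
  qed
  \<comment> \<open>Writing \<open>T\<close> for substitution of \<open>f\<close>, the array \<open>(-1)\<^sup>i (T - 1)\<^sup>n T\<^sup>j u\<close> satisfies the Pascal recursion.\<close>
  have "(difference f ^^ p) u = (-1) ^ p * u + (?T ^^ p) u"
    using pascal_recursion_prime[of p "\<lambda>n i j. (-1) ^ i * (difference f ^^ n) ((?T ^^ j) u)"] p
      comm by (simp add: algebra_simps)
  \<comment> \<open>This includes \<open>p = 2\<close>, where \<open>1 = -1\<close>.\<close>
  moreover have "(-1) ^ p * u = - u"
    using minus_power_prime_CHAR[of p "1 :: 'a fps"] p by simp
  ultimately show ?thesis
    by simp
qed

lemma of_nat_mult_eq_0_cancel:
  fixes y :: "'b::comm_ring_1"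
  assumes p: "prime p" "CHAR('b) = p" and "of_nat m * y = 0" "\<not> p dvd m"
  shows "y = 0"
proof -
  obtain l where "[m * l = 1] (mod p)"
    using cong_solve_coprime_nat[of m p] prime_imp_coprime[OF p(1) assms(4)]
    by (auto simp: coprime_commute)
  then have "of_nat (m * l) = (1 :: 'b)"
    using of_nat_eq_iff_cong_CHAR[where 'a = 'b, of "m * l" 1] p(2) by simp
  then have "y = of_nat l * (of_nat m * y)"
    by (simp add: mult_ac flip: mult.assoc)
  then show ?thesis
    using assms(3) by simp
qed

section \<open>Pth powers of a vector field\<close>

text \<open>The operator \<open>(h \<partial>)\<^sup>r h\<close> is a differential operator of order at most \<open>r\<close>; only its leading coefficient is
made explicit.\<close>

lemma vfield_expansion:
  fixes h :: "'a::comm_ring_1 fps"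
  shows "\<exists>b. b r = h ^ Suc r \<and> (\<forall>v. (vfield h ^^ r) (h * v) = (\<Sum>j\<le>r. b j * (fps_deriv ^^ j) v))"
proof (induction r)
  case 0
  show ?case
    by (intro exI[of _ "\<lambda>_. h"]) simp
next
  case (Suc r)
  then obtain b where b: "b r = h ^ Suc r"
    and *: "\<And>v. (vfield h ^^ r) (h * v) = (\<Sum>j\<le>r. b j * (fps_deriv ^^ j) v)"
    by blast
  define b1 where "b1 j = (if j \<le> r then h * fps_deriv (b j) else 0)" for j
  define b2 where "b2 j = (case j of 0 \<Rightarrow> 0 | Suc i \<Rightarrow> h * b i)" for j
  have "(vfield h ^^ Suc r) (h * v) = (\<Sum>j\<le>Suc r. (b1 j + b2 j) * (fps_deriv ^^ j) v)" for v
  proof -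
    have "(vfield h ^^ Suc r) (h * v)
        = (\<Sum>j\<le>r. h * fps_deriv (b j) * (fps_deriv ^^ j) v) + (\<Sum>j\<le>r. h * b j * (fps_deriv ^^ Suc j) v)"
      by (simp add: * vfield_def fps_deriv_sum sum_distrib_left sum.distrib algebra_simps)
    also have "(\<Sum>j\<le>r. h * fps_deriv (b j) * (fps_deriv ^^ j) v) = (\<Sum>j\<le>Suc r. b1 j * (fps_deriv ^^ j) v)"
      by (simp add: b1_def)
    also have "(\<Sum>j\<le>r. h * b j * (fps_deriv ^^ Suc j) v) = (\<Sum>j\<le>Suc r. b2 j * (fps_deriv ^^ j) v)"
      by (subst sum.atMost_Suc_shift) (simp add: b2_def)
    finally show ?thesis
      by (simp only: distrib_right sum.distrib)
  qed
  then show ?case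
    using b by (intro exI[of _ "\<lambda>j. b1 j + b2 j"]) (simp add: b1_def b2_def)
qed

lemma deriv_X_power_Suc:
  "fps_deriv (fps_X ^ Suc j :: 'a::comm_ring_1 fps) = of_nat (Suc j) * fps_X ^ j"
  by (simp add: fps_deriv_power fps_of_nat del: of_nat_Suc power_Suc)

lemma deriv_funpow_of_nat_mult:
  "(fps_deriv ^^ i) (of_nat c * u) = of_nat c * (fps_deriv ^^ i) (u :: 'a::comm_ring_1 fps)"
  by (induction i) simp_all

lemma deriv_funpow_X_power_eq_0:
  "j < i \<Longrightarrow> (fps_deriv ^^ i) (fps_X ^ j :: 'a::comm_ring_1 fps) = 0"
proof (induction j arbitrary: i)
  case 0
  have "(fps_deriv ^^ l) (0 :: 'a fps) = 0" for l
    by (induction l) simp_all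
  with 0 show ?case
    by (cases i) (simp_all add: funpow_Suc_right del: funpow.simps(2))
next
  case (Suc j)
  then obtain l where "i = Suc l" "j < l"
    by (cases i) auto
  then show ?case
    using Suc.IH[of l]
    by (simp add: funpow_Suc_right deriv_X_power_Suc deriv_funpow_of_nat_mult
        del: funpow.simps(2) power_Suc of_nat_Suc)
qed

lemma deriv_funpow_X_power_same:
  "(fps_deriv ^^ j) (fps_X ^ j :: 'a::comm_ring_1 fps) = of_nat (fact j)"
proof (induction j)
  case (Suc j)
  then show ?case
    by (simp only: funpow_Suc_right o_apply deriv_X_power_Suc deriv_funpow_of_nat_mult
        fact_Suc of_nat_mult of_nat_id)
qed simp

lemma vfield_funpow_prime_X_power:
  fixes h :: "'a::comm_ring_1 fps"
  assumes p: "prime p" "CHAR('a) = p"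
  shows "(vfield h ^^ p) (fps_X ^ j) = of_nat j * fps_X ^ (j - 1) * (vfield h ^^ p) fps_X"
proof (induction j)
  case 0
  have "vfield h 1 = 0"
    by (simp add: vfield_def)
  then show ?case
    using prime_gt_0_nat[OF p(1)] by (cases p) (simp_all add: funpow_Suc_right del: funpow.simps(2))
next
  case (Suc j)
  have "(vfield h ^^ p) (fps_X * fps_X ^ j)
      = (vfield h ^^ p) fps_X * fps_X ^ j + fps_X * (vfield h ^^ p) (fps_X ^ j)"
    by (rule derivation_funpow_prime) (use p in \<open>simp_all add: vfield_def algebra_simps\<close>)
  then show ?case
    using Suc by (cases j) (simp_all add: algebra_simps)
qed

text \<open>With \<open>D = h \<partial>\<close>, write \<open>D\<^sup>p\<^sup>-\<^sup>1 h\<close> as a differential operator with coefficients \<open>b\<^sub>0, ..., b\<^sub>p\<^sub>-\<^sub>1\<close>. Since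
\<open>D\<^sup>p\<close> is a derivation, the value of this operator at \<open>X\<^sup>j\<close>, which for \<open>j < p - 1\<close> is
\<open>D\<^sup>p (X\<^sup>j\<^sup>+\<^sup>1) / (j + 1)\<close>, equals \<open>X\<^sup>j D\<^sup>p X\<close>. Evaluating at \<open>1, X, ..., X\<^sup>p\<^sup>-\<^sup>2\<close> therefore determines
\<open>b\<^sub>0 = D\<^sup>p X\<close> and forces all coefficients strictly between the first and the last one to vanish.\<close>

lemma vfield_funpow_pred_prime_mult:
  fixes h v :: "'a::comm_ring_1 fps"
  assumes p: "prime p" "CHAR('a) = p"
  shows "(vfield h ^^ (p - 1)) (h * v) = (vfield h ^^ p) fps_X * v + h ^ p * (fps_deriv ^^ (p - 1)) v"
proof -
  let ?W = "(vfield h ^^ p) fps_X"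
  have p2: "p \<ge> 2"
    using p(1) by (rule prime_ge_2_nat)
  obtain b where top: "b (p - 1) = h ^ p"
    and b: "\<And>v. (vfield h ^^ (p - 1)) (h * v) = (\<Sum>j\<le>p - 1. b j * (fps_deriv ^^ j) v)"
    using vfield_expansion[of "p - 1" h] p2 by auto
  have char: "CHAR('a fps) = p"
    using p(2) by simp
  have X: "(\<Sum>i\<le>j. b i * (fps_deriv ^^ i) (fps_X ^ j)) = ?W * fps_X ^ j" if j: "j < p - 1" for j
  proof -
    \<comment> \<open>The factor \<open>j + 1\<close> makes \<open>h X\<^sup>j\<close> the image of \<open>X\<^sup>j\<^sup>+\<^sup>1\<close> under the vector field; being prime to \<open>p\<close>, it
    cancels afterwards.\<close>
    have "of_nat (Suc j) * (\<Sum>i\<le>p - 1. b i * (fps_deriv ^^ i) (fps_X ^ j))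
        = (vfield h ^^ (p - 1)) (h * (of_nat (Suc j) * fps_X ^ j))"
      by (simp only: b deriv_funpow_of_nat_mult sum_distrib_left mult.left_commute)
    also have "h * (of_nat (Suc j) * fps_X ^ j) = vfield h (fps_X ^ Suc j)"
      by (simp only: vfield_def deriv_X_power_Suc)
    also have "(vfield h ^^ (p - 1)) (vfield h (fps_X ^ Suc j)) = (vfield h ^^ p) (fps_X ^ Suc j)"
      using p2 by (cases p) (simp_all add: funpow_swap1)
    also have "\<dots> = of_nat (Suc j) * (?W * fps_X ^ j)"
      by (subst vfield_funpow_prime_X_power[OF p]) simp
    finally have "of_nat (Suc j) * ((\<Sum>i\<le>p - 1. b i * (fps_deriv ^^ i) (fps_X ^ j)) - ?W * fps_X ^ j) = 0"
      by (simp add: right_diff_distrib)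
    moreover have "\<not> p dvd Suc j"
      using j by (auto dest: dvd_imp_le)
    ultimately have "(\<Sum>i\<le>p - 1. b i * (fps_deriv ^^ i) (fps_X ^ j)) - ?W * fps_X ^ j = 0"
      by (rule of_nat_mult_eq_0_cancel[OF p(1) char])
    moreover have "(\<Sum>i\<le>p - 1. b i * (fps_deriv ^^ i) (fps_X ^ j :: 'a fps))
        = (\<Sum>i\<le>j. b i * (fps_deriv ^^ i) (fps_X ^ j))"
      by (rule sum.mono_neutral_right) (use j in \<open>auto simp: deriv_funpow_X_power_eq_0\<close>)
    ultimately show ?thesis
      by simp
  qed
  have b0: "b 0 = ?W"
    using X[of 0] p2 by simp
  have bj: "b j = 0" if "0 < j" "j < p - 1" for j
    using that
  proof (induction j rule: less_induct)
    case (less j)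
    have "(\<Sum>i\<le>j. b i * (fps_deriv ^^ i) (fps_X ^ j :: 'a fps))
        = (\<Sum>i\<in>{0, j}. b i * (fps_deriv ^^ i) (fps_X ^ j))"
      by (rule sum.mono_neutral_right) (use less in auto)
    then have "of_nat (fact j) * b j = 0"
      using X[of j] less.prems by (simp add: b0 deriv_funpow_X_power_same mult.commute)
    moreover have "\<not> p dvd fact j"
      using p(1) less.prems by (simp add: prime_dvd_fact_iff)
    ultimately show ?case
      using of_nat_mult_eq_0_cancel[OF p(1) char] by blast
  qed
  have "(vfield h ^^ (p - 1)) (h * v) = (\<Sum>j\<in>{0, p - 1}. b j * (fps_deriv ^^ j) v)"
    unfolding b using bj by (intro sum.mono_neutral_right) auto
  then show ?thesis
    using p2 top by (simp add: b0)
qed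

text \<open>The preceding operator identity is applied to \<open>v = h\<^sup>p\<^sup>-\<^sup>1\<close>: the left-hand side vanishes because \<open>h\<^sup>p\<close> has
derivative \<open>p h\<^sup>p\<^sup>-\<^sup>1 h' = 0\<close>.\<close>

lemma power_times_vfield_funpow_prime_eq_0:
  fixes h :: "'a::comm_ring_1 fps"
  assumes p: "prime p" "CHAR('a) = p"
  shows "h ^ (p - 1) * ((vfield h ^^ p) fps_X + h * (fps_deriv ^^ (p - 1)) (h ^ (p - 1))) = 0"
proof -
  have p2: "p \<ge> 2"
    using p(1) by (rule prime_ge_2_nat)
  have hp: "h * h ^ (p - 1) = h ^ p"
    using p2 by (simp flip: power_Suc)
  have "vfield h (h ^ p) = 0"
    using p(2) of_nat_CHAR[where 'a = "'a"] by (simp add: vfield_def fps_deriv_power flip: fps_of_nat)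
  then have "(vfield h ^^ (p - 1)) (h ^ p) = 0"
    using p2 by (cases "p - 1") (simp_all add: funpow_Suc_right del: funpow.simps(2))
  then have "0 = (vfield h ^^ p) fps_X * h ^ (p - 1) + h ^ p * (fps_deriv ^^ (p - 1)) (h ^ (p - 1))"
    using vfield_funpow_pred_prime_mult[OF p, of h "h ^ (p - 1)"] by (simp only: hp)
  also have "\<dots> = h ^ (p - 1) * ((vfield h ^^ p) fps_X + h * (fps_deriv ^^ (p - 1)) (h ^ (p - 1)))"
    by (simp only: distrib_left mult_ac flip: hp)
  finally show ?thesis ..
qed

text \<open>A series in \<open>X\<close> whose coefficients are series in a second variable \<open>\<epsilon>\<close> is specialised at \<open>\<epsilon> = 0\<close>.\<close>

definition const_slice :: "'a::comm_ring_1 fps fps \<Rightarrow> 'a fps" where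
  "const_slice F = Abs_fps (\<lambda>n. F $ n $ 0)"

lemma const_slice_hom [simp]:
  "const_slice 0 = 0" "const_slice 1 = 1" "const_slice fps_X = fps_X"
  "const_slice (F + G) = const_slice F + const_slice G"
  "const_slice (F * G) = const_slice F * const_slice G"
  "const_slice (fps_deriv F) = fps_deriv (const_slice F)"
  by (simp_all add: const_slice_def fps_eq_iff fps_mult_nth fps_sum_nth fps_X_def flip: fps_of_nat of_nat_Suc)

lemma const_slice_power [simp]: "const_slice (F ^ n) = const_slice F ^ n"
  by (induction n) simp_all

lemma const_slice_funpow [simp]:
  "const_slice ((fps_deriv ^^ n) F) = (fps_deriv ^^ n) (const_slice F)"
  "const_slice ((vfield H ^^ n) F) = (vfield (const_slice H) ^^ n) (const_slice F)"
  by (induction n) (simp_all add: vfield_def)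

text \<open>The factor \<open>h\<^sup>p\<^sup>-\<^sup>1\<close> in \<open>power_times_vfield_funpow_prime_eq_0\<close> cannot be cancelled if \<open>h\<close> is a zero
divisor. So \<open>h\<close> is
deformed to \<open>h + \<epsilon>\<close> over the ring of power series in \<open>\<epsilon>\<close>. Its constant coefficient \<open>\<epsilon>\<close> is not
a zero divisor, hence \<open>h + \<epsilon>\<close> can be cancelled; then \<open>\<epsilon>\<close> is set to \<open>0\<close>.\<close>

lemma vfield_funpow_prime_X:
  fixes h :: "'a::comm_ring_1 fps"
  assumes p: "prime p" "CHAR('a) = p" and h0: "h $ 0 = 0"
  shows "(vfield h ^^ p) fps_X = - (h * (fps_deriv ^^ (p - 1)) (h ^ (p - 1)))"
proof -
  \<comment> \<open>The inner variable plays the role of \<open>\<epsilon>\<close>.\<close>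
  define H :: "'a fps fps" where "H = Abs_fps (\<lambda>n. fps_const (h $ n)) + fps_const fps_X"
  have H0: "H $ 0 = fps_X"
    by (simp add: H_def h0)
  have "const_slice H = h"
    by (simp add: H_def const_slice_def fps_eq_iff)
  have cancel: "y = 0" if y: "H * y = 0" for y
  proof (rule fps_ext)
    fix n
    show "y $ n = 0 $ n"
    proof (induction n rule: less_induct)
      case (less n)
      have "0 = (\<Sum>i\<in>{0..n}. H $ i * y $ (n - i))"
        using y by (metis fps_mult_nth fps_zero_nth)
      also have "\<dots> = (\<Sum>i\<in>{0}. H $ i * y $ (n - i))"
        using less by (intro sum.mono_neutral_right) auto
      finally have "fps_X * y $ n = 0"
        by (simp add: H0)
      then have "(fps_X * y $ n) $ Suc i = 0" for i
        by simp
      then show ?case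
        by (simp add: fps_eq_iff)
    qed
  qed
  have cancel_power: "y = 0" if "H ^ m * y = 0" for m y
    using that by (induction m) (auto simp: mult.assoc dest: cancel)
  have "(vfield H ^^ p) fps_X + H * (fps_deriv ^^ (p - 1)) (H ^ (p - 1)) = 0"
    by (rule cancel_power[OF power_times_vfield_funpow_prime_eq_0]) (use p in simp_all)
  then have "const_slice ((vfield H ^^ p) fps_X + H * (fps_deriv ^^ (p - 1)) (H ^ (p - 1))) = 0"
    by simp
  then show ?thesis
    by (simp add: \<open>const_slice H = h\<close> eq_neg_iff_add_eq_0)
qed

section \<open>The derivative of order p - 1\<close>

lemma nth_deriv_funpow:
  fixes u :: "'a::comm_ring_1 fps"
  shows "(fps_deriv ^^ r) u $ N = of_nat (pochhammer (Suc N) r) * u $ (N + r)"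
proof (induction r arbitrary: N)
  case (Suc r)
  show ?case
    by (simp add: Suc pochhammer_rec distrib_right mult.assoc)
qed simp

text \<open>The product \<open>(N + 1) ... (N + p - 1)\<close> runs over all residue classes except that of \<open>N\<close>. It contains
the class \<open>0\<close> unless \<open>p\<close> divides \<open>N\<close>, and in that case Wilson's theorem evaluates it.\<close>

lemma of_nat_pochhammer_pred_prime:
  assumes p: "prime p" "CHAR('a::comm_ring_1) = p"
  shows "(of_nat (pochhammer (Suc N) (p - 1)) :: 'a) = (if p dvd N then - 1 else 0)"
proof (cases "p dvd N")
  case True
  then have "of_nat N = (0 :: 'a)"
    using p(2) of_nat_eq_0_iff_char_dvd by blast
  then have "(of_nat (pochhammer (Suc N) (p - 1)) :: 'a) = of_nat (fact (p - 1))"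
    by (simp add: pochhammer_fact flip: pochhammer_of_nat)
  also have "\<dots> = of_int (fact (p - 1))"
    using of_int_of_nat_eq[of "fact (p - 1)", where 'a = 'a] by simp
  also have "\<dots> = of_int (- 1)"
    using wilson_theorem[OF p(1)] p(2) of_int_eq_iff_cong_CHAR[where 'a = 'a] by blast
  finally show ?thesis
    using True by simp
next
  case False
  define i where "i = p - 1 - N mod p"
  have "N mod p < p" "N mod p \<noteq> 0"
    using False p(1) by (auto simp: prime_gt_0_nat dvd_eq_mod_eq_0)
  then have i: "i < p - 1" and "Suc N + i = p * (N div p) + p"
    using mult_div_mod_eq[of p N] unfolding i_def by linarith+
  then have "p dvd Suc N + i"
    by simp
  then have "p dvd (\<Prod>i = 0..<p - 1. Suc N + i)"
    using i by (meson atLeastLessThan_iff dvd_prodI dvd_trans finite_atLeastLessThan zero_le)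
  then have "p dvd pochhammer (Suc N) (p - 1)"
    by (simp add: pochhammer_prod)
  then show ?thesis
    using False p(2) of_nat_eq_0_iff_char_dvd[where 'a = 'a] by simp
qed

lemma nth_deriv_pred_prime:
  fixes u :: "'a::comm_ring_1 fps"
  assumes p: "prime p" "CHAR('a) = p"
  shows "(fps_deriv ^^ (p - 1)) u $ N = (if p dvd N then - (u $ (N + (p - 1))) else 0)"
  unfolding nth_deriv_funpow of_nat_pochhammer_pred_prime[OF p] by simp

text \<open>Only exponents divisible by \<open>p\<close> survive under \<open>\<partial>\<^sup>p\<^sup>-\<^sup>1\<close>, so its result has order at least the first
multiple of \<open>p\<close> that is reachable. This is where orders jump further than expected.\<close>

lemma deriv_pred_prime_dvd:
  fixes u :: "'a::comm_ring_1 fps"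
  assumes p: "prime p" "CHAR('a) = p" and "p dvd r" "r \<le> m" "fps_X ^ m dvd u"
  shows "fps_X ^ r dvd (fps_deriv ^^ (p - 1)) u"
proof -
  have "N + (p - 1) < m" if "N < r" "p dvd N" for N
  proof -
    have "p \<le> r - N"
      using that assms(3) by (intro dvd_imp_le dvd_diff_nat) auto
    then show ?thesis
      using that assms(4) prime_gt_0_nat[OF p(1)] by simp
  qed
  then show ?thesis
    using assms(5) unfolding X_power_dvd_iff nth_deriv_pred_prime[OF p] by simp
qed

lemma deriv_funpow_dvd:
  fixes u :: "'a::comm_ring_1 fps"
  assumes "fps_X ^ (m + r) dvd u"
  shows "fps_X ^ m dvd (fps_deriv ^^ r) u"
  using assms by (simp add: X_power_dvd_iff nth_deriv_funpow)

lemma deriv_funpow_diff: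
  "(fps_deriv ^^ r) (u - v) = (fps_deriv ^^ r) u - (fps_deriv ^^ r) (v :: 'a::comm_ring_1 fps)"
  by (induction r) simp_all

section \<open>Comparing pth powers of series\<close>

lemma power_prime_diff_approx:
  fixes f g :: "'a::comm_ring_1 fps"
  assumes p: "prime p" "CHAR('a) = p"
    and f: "fps_X ^ Suc k dvd f - fps_X" and g: "fps_X ^ Suc k dvd g - fps_X"
    and fg: "fps_X ^ Suc (k + d) dvd g - f"
  shows "fps_X ^ Suc (p * k + k + d) dvd
    (g [^]\<^bsub>nottingham\<^esub> p - f [^]\<^bsub>nottingham\<^esub> p)
    - ((vfield (g - fps_X) ^^ p) fps_X - (vfield (f - fps_X) ^^ p) fps_X)"
  using difference_funpow_vfield_funpow_compare[OF f g fg, of p]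
  by (simp add: difference_funpow_prime[OF p] nottingham_power_eq_funpow)

text \<open>Up to sign, the factor by which \<open>D\<^sup>p\<close> is a multiple of \<open>D\<close> for the vector field \<open>D = h \<partial>\<close>;
compare \<open>vfield_funpow_prime_X\<close>.\<close>

definition pth_power_factor :: "'a::comm_ring_1 fps \<Rightarrow> 'a fps" where
  "pth_power_factor h = (fps_deriv ^^ (CHAR('a) - 1)) (h ^ (CHAR('a) - 1))"

text \<open>The product rule for differences; the two summands are the two kinds of terms whose
orders and leading coefficients are studied below.\<close>

lemma vfield_funpow_prime_diff:
  fixes f g :: "'a::comm_ring_1 fps"
  assumes p: "prime p" "CHAR('a) = p" and "f $ 0 = 0" "g $ 0 = 0"
  shows "(vfield (g - fps_X) ^^ p) fps_X - (vfield (f - fps_X) ^^ p) fps_X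
    = - ((g - f) * pth_power_factor (g - fps_X) + (f - fps_X) * (pth_power_factor (g - fps_X) - pth_power_factor (f - fps_X)))"
proof -
  have "(vfield h ^^ p) fps_X = - (h * pth_power_factor h)" if "h $ 0 = 0" for h :: "'a fps"
    unfolding pth_power_factor_def p(2) using that by (rule vfield_funpow_prime_X[OF p])
  then show ?thesis
    using assms by (simp add: algebra_simps)
qed

lemma pred_prime_power_dvd:
  fixes h :: "'a::comm_ring_1 fps"
  assumes "fps_X ^ Suc k dvd h"
  shows "fps_X ^ ((p - 1) * k + (p - 1)) dvd h ^ (p - 1)"
  using X_power_dvd_power[OF assms, of "p - 1"] by (simp add: add.commute)

lemma pred_prime_power_diff_dvd:
  fixes h h' :: "'a::comm_ring_1 fps"
  assumes "prime p" "fps_X ^ Suc k dvd h" "fps_X ^ Suc k dvd h'" "fps_X ^ Suc n dvd h' - h"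
  shows "fps_X ^ (n + (p - 2) * k + (p - 1)) dvd h' ^ (p - 1) - h ^ (p - 1)"
proof -
  obtain q where q: "p = Suc (Suc q)"
    using prime_ge_2_nat[OF assms(1)] by (metis add_2_eq_Suc le_Suc_ex)
  then have "Suc n + q * Suc k = n + (p - 2) * k + (p - 1)"
    by simp
  then show ?thesis
    using power_diff_dvd[OF assms(2-4), of q] q by (simp only: diff_Suc_1)
qed

lemma dvd_pred_mult_add_mod:
  fixes p k :: nat
  assumes "p > 0"
  shows "p dvd (p - 1) * k + k mod p"
proof -
  have "(p - 1) * k + k mod p + p * (k div p) = (p - 1) * k + k"
    by simp
  also have "\<dots> = p * k"
    using assms by (cases p) simp_all
  finally show ?thesis
    by (metis dvd_add_left_iff dvd_triv_left)
qed

text \<open>The two summands of \<open>vfield_funpow_prime_diff\<close> are products. Of their first factors \<open>g - f\<close> and \<open>f - X\<close>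
only the order is used; the second factors come from \<open>\<partial>\<^sup>p\<^sup>-\<^sup>1\<close>, so their orders may be rounded up to the
multiples \<open>(p - 1) k + k mod p\<close> and \<open>n + (p - 2) k + i\<close> of \<open>p\<close>.\<close>

lemma power_prime_diff_dvd:
  fixes f g :: "'a::comm_ring_1 fps"
  assumes p: "prime p" "CHAR('a) = p"
    and f: "fps_X ^ Suc k dvd f - fps_X" and g: "fps_X ^ Suc k dvd g - fps_X"
    and fg: "fps_X ^ Suc n dvd g - f" and "k \<le> n"
    and i: "i < p" "p dvd n + (p - 2) * k + i"
  shows "fps_X ^ Suc (n + (p - 1) * k + min i (k mod p)) dvd
    g [^]\<^bsub>nottingham\<^esub> p - f [^]\<^bsub>nottingham\<^esub> p"
proof -
  let ?Cf = "pth_power_factor (f - fps_X)" and ?Cg = "pth_power_factor (g - fps_X)"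
  let ?N = "Suc (n + (p - 1) * k + min i (k mod p))"
  obtain q where q: "p = Suc (Suc q)"
    using prime_ge_2_nat[OF p(1)] by (metis add_2_eq_Suc le_Suc_ex)
  have k: "k mod p \<le> k" "k mod p < p"
    using prime_gt_0_nat[OF p(1)] by auto
  have min_k: "min i (k mod p) \<le> k"
    using k(1) by (rule min.coboundedI2)
  have r: "p dvd (p - 1) * k + k mod p"
    by (rule dvd_pred_mult_add_mod) (simp add: q)
  have "fps_X ^ ((p - 1) * k + k mod p) dvd ?Cg"
    unfolding pth_power_factor_def p(2)
    by (rule deriv_pred_prime_dvd[OF p r _ pred_prime_power_dvd[OF g]]) (use k in simp)
  then have 1: "fps_X ^ ?N dvd (g - f) * ?Cg"
    by (rule X_power_dvd_mult[OF fg]) simp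
  have "fps_X ^ (n + (p - 2) * k + i) dvd ?Cg - ?Cf"
    unfolding pth_power_factor_def p(2) deriv_funpow_diff[symmetric]
    by (rule deriv_pred_prime_dvd[OF p i(2) _ pred_prime_power_diff_dvd[OF p(1) f g]])
      (use i fg in simp_all)
  then have 2: "fps_X ^ ?N dvd (f - fps_X) * (?Cg - ?Cf)"
    by (rule X_power_dvd_mult[OF f]) (simp add: q)
  have fg': "fps_X ^ Suc (k + (n - k)) dvd g - f"
    using fg \<open>k \<le> n\<close> by simp
  have approx: "fps_X ^ ?N dvd (g [^]\<^bsub>nottingham\<^esub> p - f [^]\<^bsub>nottingham\<^esub> p)
      - ((vfield (g - fps_X) ^^ p) fps_X - (vfield (f - fps_X) ^^ p) fps_X)"
    by (rule X_power_dvd_le[OF power_prime_diff_approx[OF p f g fg']])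
      (use \<open>k \<le> n\<close> min_k q in simp)
  have W: "fps_X ^ ?N dvd (vfield (g - fps_X) ^^ p) fps_X - (vfield (f - fps_X) ^^ p) fps_X"
    unfolding vfield_funpow_prime_diff[OF p nth_0_eq_0_of_dvd_minus_X[OF f] nth_0_eq_0_of_dvd_minus_X[OF g]]
    using dvd_add[OF 1 2] by (simp only: dvd_minus_iff)
  from dvd_add[OF approx W] show ?thesis
    by (simp only: diff_add_cancel)
qed

lemma prime_dvd_pred_mult_iff:
  assumes "prime (p :: nat)"
  shows "p dvd (p - 1) * k \<longleftrightarrow> p dvd k"
proof -
  have "\<not> p dvd p - 1"
    using prime_gt_1_nat[OF assms] by (auto dest: dvd_imp_le)
  then show ?thesis
    using prime_dvd_mult_iff[OF assms] by simp
qed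

lemma nth_pth_power_factor:
  fixes h :: "'a::comm_ring_1 fps"
  assumes p: "prime p" "CHAR('a) = p" and "fps_X ^ Suc k dvd h"
  shows "pth_power_factor h $ ((p - 1) * k) = (if p dvd k then - ((h $ Suc k) ^ (p - 1)) else 0)"
  using leading_coeff_power[OF assms(3), of "p - 1"]
  unfolding pth_power_factor_def p(2) nth_deriv_pred_prime[OF p] prime_dvd_pred_mult_iff[OF p(1)]
  by (simp add: add.commute)

text \<open>Both summands of \<open>vfield_funpow_prime_diff\<close> can contribute in this degree, each under its own
divisibility condition. The second one carries the factor \<open>p - 1 = -1\<close> from the derivative of the
\<open>(p - 1)\<close>st power, whence the difference of the two indicators.\<close>

lemma leading_coeff_power_prime_diff:
  fixes f g :: "'a::comm_ring_1 fps"
  assumes p: "prime p" "CHAR('a) = p"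
    and f: "fps_X ^ Suc k dvd f - fps_X"
    and fg: "fps_X ^ Suc n dvd g - f" and "1 \<le> k" "k < n"
  shows "(g [^]\<^bsub>nottingham\<^esub> p - f [^]\<^bsub>nottingham\<^esub> p) $ Suc (n + (p - 1) * k)
    = (of_bool (p dvd k) - of_bool (p dvd n + (p - 2) * k))
      * (g - f) $ Suc n * ((f - fps_X) $ Suc k) ^ (p - 1)"
proof -
  let ?Cf = "pth_power_factor (f - fps_X)" and ?Cg = "pth_power_factor (g - fps_X)"
  let ?\<alpha> = "(f - fps_X) $ Suc k" and ?s = "(g - f) $ Suc n" and ?N = "Suc (n + (p - 1) * k)"
  obtain q where q: "p = Suc (Suc q)"
    using prime_ge_2_nat[OF p(1)] by (metis add_2_eq_Suc le_Suc_ex)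
  have "fps_X ^ Suc k dvd (g - f) + (f - fps_X)"
    using f X_power_dvd_le[OF fg, of "Suc k"] \<open>k < n\<close> by (intro dvd_add) auto
  then have g: "fps_X ^ Suc k dvd g - fps_X"
    by simp
  have fg': "fps_X ^ Suc (k + (n - k)) dvd g - f" and fg'': "fps_X ^ Suc n dvd (g - fps_X) - (f - fps_X)"
    using fg \<open>k < n\<close> by simp_all
  have \<alpha>: "(g - fps_X) $ Suc k = ?\<alpha>"
    using fg \<open>k < n\<close> unfolding X_power_dvd_iff by (auto dest!: spec[of _ "Suc k"])
  have Cg: "fps_X ^ ((p - 1) * k) dvd ?Cg"
    unfolding pth_power_factor_def p(2) by (intro deriv_funpow_dvd pred_prime_power_dvd g)
  have C: "fps_X ^ (n + (p - 2) * k) dvd ?Cg - ?Cf"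
    unfolding pth_power_factor_def p(2) deriv_funpow_diff[symmetric]
    by (intro deriv_funpow_dvd pred_prime_power_diff_dvd p f g fg'')
  have 1: "((g - f) * ?Cg) $ ?N = - of_bool (p dvd k) * ?s * ?\<alpha> ^ (p - 1)"
    using leading_coeff_mult[OF fg Cg] \<alpha> nth_pth_power_factor[OF p g] by simp
  have idx: "n + (p - 2) * k + (p - 1) = Suc n + q * Suc k" "?N = Suc k + (n + (p - 2) * k)"
    and pow: "?\<alpha> * ?\<alpha> ^ q = ?\<alpha> ^ (p - 1)" and pq: "p - 1 = Suc q"
    by (simp_all add: q)
  have "(?Cg - ?Cf) $ (n + (p - 2) * k)
      = - of_bool (p dvd n + (p - 2) * k) * of_nat (p - 1) * ?s * ?\<alpha> ^ q"
    using leading_coeff_power_diff[OF f g fg'', of q] \<open>k < n\<close>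
    unfolding pth_power_factor_def p(2) deriv_funpow_diff[symmetric] nth_deriv_pred_prime[OF p] idx(1)
    by (simp add: pq del: One_nat_def of_nat_Suc power_Suc fps_sub_nth)
  moreover have "of_nat (p - 1) = (- 1 :: 'a)"
    using of_nat_CHAR[where 'a = 'a] p(2) q by (simp add: eq_neg_iff_add_eq_0 add.commute)
  ultimately have 2: "((f - fps_X) * (?Cg - ?Cf)) $ ?N = of_bool (p dvd n + (p - 2) * k) * ?s * ?\<alpha> ^ (p - 1)"
    unfolding idx(2) leading_coeff_mult[OF f C] pow[symmetric]
    by (simp only: mult_minus_left mult_minus_right mult_1_right minus_minus mult_1_left
        mult.left_commute mult.commute)
  have "?N < Suc (p * k + k + (n - k))"
    using \<open>1 \<le> k\<close> \<open>k < n\<close> by (simp add: q)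
  then have "((g [^]\<^bsub>nottingham\<^esub> p - f [^]\<^bsub>nottingham\<^esub> p)
      - ((vfield (g - fps_X) ^^ p) fps_X - (vfield (f - fps_X) ^^ p) fps_X)) $ ?N = 0"
    using power_prime_diff_approx[OF p f g fg'] unfolding X_power_dvd_iff by blast
  then have "(g [^]\<^bsub>nottingham\<^esub> p - f [^]\<^bsub>nottingham\<^esub> p) $ ?N
      = ((vfield (g - fps_X) ^^ p) fps_X - (vfield (f - fps_X) ^^ p) fps_X) $ ?N"
    by simp
  also have "\<dots> = - (((g - f) * ?Cg) $ ?N + ((f - fps_X) * (?Cg - ?Cf)) $ ?N)"
    unfolding vfield_funpow_prime_diff[OF p nth_0_eq_0_of_dvd_minus_X[OF f] nth_0_eq_0_of_dvd_minus_X[OF g]]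
    by (simp only: fps_neg_nth fps_add_nth)
  finally show ?thesis
    unfolding 1 2 by (simp add: algebra_simps)
qed

lemma X_nat_pow [simp]: "fps_X [^]\<^bsub>nottingham\<^esub> (i :: nat) = (fps_X :: 'a::comm_ring_1 fps)"
  by (induction i) simp_all

text \<open>This complements \<open>leading_coeff_power_prime_diff\<close> by the case \<open>n = k\<close>, with \<open>X\<close> as the other series.\<close>

lemma leading_coeff_power_prime:
  fixes f :: "'a::comm_ring_1 fps"
  assumes p: "prime p" "CHAR('a) = p"
    and f: "fps_X ^ Suc k dvd f - fps_X" and "p dvd k" "k \<ge> 1"
  shows "(f [^]\<^bsub>nottingham\<^esub> p - fps_X) $ Suc (p * k) = ((f - fps_X) $ Suc k) ^ p"
proof -
  let ?\<phi> = "f - fps_X"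
  obtain q where q: "p = Suc q"
    using prime_gt_0_nat[OF p(1)] by (metis gr0_implies_Suc)
  have "(vfield (0 :: 'a fps) ^^ p) fps_X = 0"
    by (simp add: q vfield_def)
  then have "fps_X ^ Suc (p * k + k) dvd (f [^]\<^bsub>nottingham\<^esub> p - fps_X) - (vfield ?\<phi> ^^ p) fps_X"
    using power_prime_diff_approx[OF p _ f, of fps_X 0] f by simp
  then have "(f [^]\<^bsub>nottingham\<^esub> p - fps_X) $ Suc (p * k) = (vfield ?\<phi> ^^ p) fps_X $ Suc (p * k)"
    using \<open>k \<ge> 1\<close> q unfolding X_power_dvd_iff by (auto dest!: spec[of _ "Suc (p * k)"])
  also have "\<dots> = - (?\<phi> * pth_power_factor ?\<phi>) $ (Suc k + (p - 1) * k)"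
    using vfield_funpow_prime_X[OF p, of ?\<phi>] nth_0_eq_0_of_dvd_minus_X[OF f] by (simp add: pth_power_factor_def p q)
  also have "\<dots> = - (?\<phi> $ Suc k * pth_power_factor ?\<phi> $ ((p - 1) * k))"
  proof -
    have "fps_X ^ ((p - 1) * k) dvd pth_power_factor ?\<phi>"
      unfolding pth_power_factor_def p(2) by (intro deriv_funpow_dvd pred_prime_power_dvd f)
    then show ?thesis
      using leading_coeff_mult[OF f] by simp
  qed
  also have "\<dots> = (?\<phi> $ Suc k) ^ p"
    using \<open>p dvd k\<close> unfolding nth_pth_power_factor[OF p f] by (simp add: q del: fps_sub_nth)
  finally show ?thesis .
qed

section \<open>The lower bound\<close>

lemma ex_residue:
  fixes p m :: nat
  assumes "p > 0"
  obtains i where "i < p" "p dvd m + i"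
proof
  show "(p - 1) * m mod p < p"
    using assms by simp
  have "m + (p - 1) * m = p * m"
    using assms by (cases p) simp_all
  then show "p dvd m + (p - 1) * m mod p"
    by (metis dvd_triv_left mod_add_right_eq mod_eq_0_iff_dvd)
qed

lemma residue_unique:
  fixes p m :: nat
  assumes "i < p" "j < p" "p dvd m + i" "p dvd m + j"
  shows "i = j"
proof -
  have "i = j" if "i \<le> j" "j < p" "p dvd m + i" "p dvd m + j" for i j :: nat
  proof -
    have "p dvd (m + j) - (m + i)"
      using that by (intro dvd_diff_nat)
    then show ?thesis
      using that by (auto dest: dvd_imp_le)
  qed
  then show ?thesis
    using assms by (metis nat_le_linear)
qed

lemma depth_excess_cong_iff:
  fixes p n k i :: nat
  assumes "p \<ge> 2"
  shows "[int n = 2 * int k - int i] (mod int p) \<longleftrightarrow> p dvd n + (p - 2) * k + i"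
proof -
  obtain q where "p = Suc (Suc q)"
    using assms by (metis add_2_eq_Suc le_Suc_ex)
  then have "int (n + (p - 2) * k + i) = (int n - (2 * int k - int i)) + int p * int k"
    by (simp add: algebra_simps)
  then have "int p dvd int (n + (p - 2) * k + i) \<longleftrightarrow> int p dvd int n - (2 * int k - int i)"
    by (simp only: dvd_add_left_iff dvd_triv_left)
  then show ?thesis
    by (simp only: cong_iff_dvd_diff int_dvd_int_iff)
qed

text \<open>The two cases of the definition for \<open>p\<close> not dividing \<open>k\<close> merge when \<open>i\<close> denotes the least residue of
\<open>2 k - n\<close>, here described without subtraction.\<close>

lemma depth_excess_eq_min:
  assumes p: "prime p" and "\<not> p dvd k" and i: "i < p" "p dvd n + (p - 2) * k + i"
  shows "depth_excess p k n = min i (k mod p)"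
proof -
  have "k mod p < p"
    using prime_gt_0_nat[OF p] by simp
  then have *: "j \<le> k mod p \<and> p dvd n + (p - 2) * k + j \<longleftrightarrow> j = i \<and> i \<le> k mod p" for j
  proof (cases "j \<le> k mod p")
    case True
    then have "j < p"
      using \<open>k mod p < p\<close> by linarith
    then show ?thesis
      using True i residue_unique[of j p i "n + (p - 2) * k"] by auto
  qed auto
  have "depth_excess p k n = (if \<exists>j. j \<le> k mod p \<and> p dvd n + (p - 2) * k + j
      then (THE j. j \<le> k mod p \<and> p dvd n + (p - 2) * k + j) else k mod p)"
    using \<open>\<not> p dvd k\<close> by (simp only: depth_excess_def depth_excess_cong_iff[OF prime_ge_2_nat[OF p]] if_False)
  then show ?thesis
    unfolding * by auto
qed

lemma depth_excess_dvd:
  "p dvd k \<Longrightarrow> depth_excess p k n = (if p dvd n \<and> n > k then 1 else 0)"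
  by (simp add: depth_excess_def)

lemma power_prime_diff_dvd_excess:
  fixes f g :: "'a::comm_ring_1 fps"
  assumes p: "prime p" "CHAR('a) = p" and k: "1 \<le> k" "k \<le> n"
    and f: "fps_X ^ Suc k dvd f - fps_X" and fg: "fps_X ^ Suc n dvd g - f"
  shows "fps_X ^ Suc (n + (p - 1) * k + depth_excess p k n) dvd
    g [^]\<^bsub>nottingham\<^esub> p - f [^]\<^bsub>nottingham\<^esub> p"
proof -
  obtain i where i: "i < p" "p dvd n + (p - 2) * k + i"
    using ex_residue[OF prime_gt_0_nat[OF p(1)]] .
  have "fps_X ^ Suc k dvd (g - f) + (f - fps_X)"
    using f X_power_dvd_le[OF fg, of "Suc k"] k by (intro dvd_add) auto
  then have g: "fps_X ^ Suc k dvd g - fps_X"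
    by simp
  note bound = power_prime_diff_dvd[OF p f g fg k(2) i]
  show ?thesis
  proof (cases "p dvd k")
    case False
    then show ?thesis
      using bound depth_excess_eq_min[OF p(1) False i] by simp
  next
    case True
    have weak: "fps_X ^ Suc (n + (p - 1) * k) dvd g [^]\<^bsub>nottingham\<^esub> p - f [^]\<^bsub>nottingham\<^esub> p"
      by (rule X_power_dvd_le[OF bound]) simp
    show ?thesis
    proof (cases "p dvd n \<and> n > k")
      case False
      then have "depth_excess p k n = 0"
        unfolding depth_excess_dvd[OF True] by simp
      then show ?thesis
        using weak by simp
    next
      case n: True
      have "(g [^]\<^bsub>nottingham\<^esub> p - f [^]\<^bsub>nottingham\<^esub> p) $ Suc (n + (p - 1) * k) = 0"
        using leading_coeff_power_prime_diff[OF p f fg k(1)] n True by simp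
      then have "fps_X ^ Suc (Suc (n + (p - 1) * k)) dvd g [^]\<^bsub>nottingham\<^esub> p - f [^]\<^bsub>nottingham\<^esub> p"
        using weak X_power_Suc_dvd_iff by blast
      then show ?thesis
        using n depth_excess_dvd[OF True] by (simp del: power_Suc)
    qed
  qed
qed

section \<open>Sharpness\<close>

lemma char_prime_one_neq_zero:
  assumes "prime p" "CHAR('a::comm_ring_1) = p"
  shows "(1 :: 'a) \<noteq> 0"
  using assms of_nat_eq_0_iff_char_dvd[of 1, where 'a = 'a] by auto

text \<open>The series \<open>X + X\<^sup>k\<^sup>+\<^sup>1\<close> and its perturbation by \<open>X\<close> to the power \<open>n' + 1\<close> have \<open>p\<close>th powers whose difference
is a unit times a power of \<open>X\<close> to leading order. So \<open>g\<^sup>p\<close> cannot agree with both of them in that degree.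
For \<open>n = k\<close> the series \<open>g\<close> is \<open>X\<close>, and the lemma then produces a series \<open>f\<close> with \<open>f\<^sup>p\<close> of known depth.\<close>

lemma ex_sharp_pair_below:
  fixes p k n n' :: nat
  assumes p: "prime p" "CHAR('a::comm_ring_1) = p" and k: "1 \<le> k" "k < n'" "n < n'"
    and n': "(p dvd k) \<noteq> (p dvd n' + (p - 2) * k)"
  defines "g \<equiv> fps_X + fps_X ^ Suc k - fps_X ^ Suc n :: 'a::comm_ring_1 fps"
  obtains f :: "'a::comm_ring_1 fps" where "fps_X ^ Suc k dvd f - fps_X" "(f - fps_X) $ Suc k = 1"
    "fps_X ^ Suc n dvd g - f" "(g - f) $ Suc n = - 1"
    "(g [^]\<^bsub>nottingham\<^esub> p - f [^]\<^bsub>nottingham\<^esub> p) $ Suc (n' + (p - 1) * k) \<noteq> 0"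
proof -
  define f0 :: "'a fps" where "f0 = fps_X + fps_X ^ Suc k"
  define f1 where "f1 = f0 + fps_X ^ Suc n'"
  let ?N = "Suc (n' + (p - 1) * k)"
  let ?good = "\<lambda>f. fps_X ^ Suc k dvd f - fps_X \<and> (f - fps_X) $ Suc k = 1 \<and>
    fps_X ^ Suc n dvd g - f \<and> (g - f) $ Suc n = - 1"
  have f0: "?good f0" and f1: "?good f1"
    using k unfolding g_def f0_def f1_def X_power_dvd_iff by (auto simp: fps_X_power_nth)
  have d: "fps_X ^ Suc n' dvd f1 - f0" "(f1 - f0) $ Suc n' = 1"
    by (simp_all add: f1_def fps_X_power_nth del: power_Suc)
  have "(f1 [^]\<^bsub>nottingham\<^esub> p - f0 [^]\<^bsub>nottingham\<^esub> p) $ ?N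
      = of_bool (p dvd k) - of_bool (p dvd n' + (p - 2) * k)"
    using leading_coeff_power_prime_diff[OF p _ d(1) k(1,2)] f0 d(2) by simp
  also have "\<dots> \<noteq> 0"
    using n' char_prime_one_neq_zero[OF p] by (auto simp: of_bool_def)
  finally have "(g [^]\<^bsub>nottingham\<^esub> p - f0 [^]\<^bsub>nottingham\<^esub> p) $ ?N \<noteq> 0
      \<or> (g [^]\<^bsub>nottingham\<^esub> p - f1 [^]\<^bsub>nottingham\<^esub> p) $ ?N \<noteq> 0"
    by auto
  then show thesis
    using f0 f1 that by blast
qed

text \<open>Both compositions are expanded to first order around \<open>X\<close>; what remains is the Lie bracket of
\<open>X\<^sup>j\<^sup>+\<^sup>1 \<partial>\<close> and of the leading term of \<open>(F - X) \<partial>\<close>.\<close>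

lemma leading_coeff_commutator:
  fixes F :: "'a::comm_ring_1 fps" and j m :: nat
  assumes F: "fps_X ^ Suc m dvd F - fps_X" and "1 \<le> m" "1 \<le> j"
  defines "u \<equiv> fps_X + fps_X ^ Suc j"
  shows "fps_X ^ Suc (j + m) dvd (u oo F) - (F oo u)"
    and "((u oo F) - (F oo u)) $ Suc (j + m) = (of_nat j - of_nat m) * (F - fps_X) $ Suc m"
proof -
  let ?\<phi> = "F - fps_X" and ?N = "Suc (j + m)"
  have F0: "F $ 0 = 0" and u0: "u $ 0 = 0"
    using nth_0_eq_0_of_dvd_minus_X[OF F] by (simp_all add: u_def)
  have u: "fps_X ^ Suc j dvd u - fps_X"
    by (simp add: u_def)
  define E1 where "E1 = F ^ Suc j - fps_X ^ Suc j - ?\<phi> * (of_nat (Suc j) * fps_X ^ j)"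
  define E2 where "E2 = (?\<phi> oo u) - ?\<phi> - fps_X ^ Suc j * fps_deriv ?\<phi>"
  define M where "M = ?\<phi> * (of_nat (Suc j) * fps_X ^ j) - fps_X ^ Suc j * fps_deriv ?\<phi>"
  have "(u oo F) - (F oo u) = M + E1 - E2"
    by (simp add: u_def E1_def E2_def M_def fps_compose_add_distrib fps_compose_sub_distrib
        compose_power[OF F0] F0 u0[unfolded u_def] algebra_simps del: power_Suc)
  \<comment> \<open>Both Taylor errors lie beyond the degree of interest because \<open>j\<close> and \<open>m\<close> are positive.\<close>
  moreover have "fps_X ^ Suc ?N dvd E1"
    using taylor_power[of m fps_X F m "Suc j"] F \<open>1 \<le> m\<close> unfolding E1_def deriv_X_power_Suc
    by (auto intro: X_power_dvd_le simp del: power_Suc of_nat_Suc)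
  moreover have "fps_X ^ Suc ?N dvd E2"
    using taylor_compose[of j fps_X u j "Suc m" ?\<phi>] u F \<open>1 \<le> j\<close> unfolding E2_def
    by (auto intro: X_power_dvd_le simp: u_def simp del: power_Suc of_nat_Suc)
  ultimately have E: "fps_X ^ Suc ?N dvd ((u oo F) - (F oo u)) - M"
    by (simp add: add_diff_eq del: power_Suc)
  have "fps_X ^ ?N dvd ?\<phi> * (of_nat (Suc j) * fps_X ^ j)"
    by (rule X_power_dvd_mult[OF F, of j]) simp_all
  moreover have "fps_X ^ ?N dvd fps_X ^ Suc j * fps_deriv ?\<phi>"
    by (rule X_power_dvd_mult_deriv[where d = j, OF _ F]) simp_all
  ultimately have M: "fps_X ^ ?N dvd M"
    unfolding M_def by (rule dvd_diff)
  have "fps_X ^ ?N dvd ((u oo F) - (F oo u)) - M"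
    by (rule X_power_dvd_le[OF E]) simp
  from dvd_add[OF this M] show "fps_X ^ Suc (j + m) dvd (u oo F) - (F oo u)"
    by (simp only: diff_add_cancel)
  have "((u oo F) - (F oo u)) $ ?N = M $ ?N"
    using E unfolding X_power_dvd_iff by simp
  also have "\<dots> = (?\<phi> * (fps_const (of_nat (Suc j)) * fps_X ^ j)) $ (Suc m + j)
      - (fps_X ^ Suc j * fps_deriv ?\<phi>) $ (Suc j + m)"
    by (simp add: M_def fps_of_nat add.commute del: power_Suc of_nat_Suc)
  also have "\<dots> = of_nat (Suc j) * ?\<phi> $ Suc m - of_nat (Suc m) * ?\<phi> $ Suc m"
  proof -
    have eq: "?\<phi> * (fps_const (of_nat (Suc j)) * fps_X ^ j) = fps_const (of_nat (Suc j)) * (?\<phi> * fps_X ^ j)"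
      by (simp only: mult.left_commute)
    show ?thesis
      unfolding eq by (simp add: fps_X_power_mult_right_nth fps_X_power_mult_nth
          del: power_Suc of_nat_Suc fps_sub_nth fps_deriv_sub)
  qed
  finally show "((u oo F) - (F oo u)) $ Suc (j + m) = (of_nat j - of_nat m) * (F - fps_X) $ Suc m"
    by (simp add: algebra_simps)
qed

lemma carrier_of_dvd:
  fixes f :: "'a::comm_ring_1 fps"
  assumes "fps_X ^ Suc k dvd f - fps_X" "1 \<le> k"
  shows "f \<in> carrier nottingham"
  using assms unfolding nottingham_carrier_iff X_power_dvd_iff
  by (auto dest: spec[of _ 0] spec[of _ 1])

text \<open>If \<open>G = u F u\<^sup>-\<^sup>1\<close>, then substituting \<open>u\<close> into \<open>G - F\<close> gives the commutator difference. The coefficient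
\<open>j - m\<close> is written as \<open>j + (p - 1) m\<close> so that it is a natural number.\<close>

lemma conjugate_minus:
  fixes F G :: "'a::comm_ring_1 fps" and j m :: nat
  assumes p: "prime p" "CHAR('a) = p"
    and F: "fps_X ^ Suc m dvd F - fps_X" and "1 \<le> m" "1 \<le> j"
    and G: "G oo (fps_X + fps_X ^ Suc j) = (fps_X + fps_X ^ Suc j) oo F"
    and "G $ 0 = 0"
  shows "fps_X ^ Suc (j + m) dvd G - F"
    and "(G - F) $ Suc (j + m) = of_nat (j + (p - 1) * m) * (F - fps_X) $ Suc m"
proof -
  interpret group "nottingham :: 'a fps monoid"
    by (rule group_nottingham)
  define u :: "'a fps" where "u = fps_X + fps_X ^ Suc j"
  have "u \<in> carrier nottingham"
    using \<open>1 \<le> j\<close> by (intro carrier_of_dvd[of j]) (simp_all add: u_def)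
  define v where "v = inv\<^bsub>nottingham\<^esub> u"
  have v: "v $ 0 = 0" "v $ 1 = 1"
    using inv_closed[OF \<open>u \<in> carrier nottingham\<close>] by (auto simp: v_def nottingham_carrier_iff)
  have u0: "u $ 0 = 0"
    by (simp add: u_def)
  have "u oo v = fps_X"
    using r_inv[OF \<open>u \<in> carrier nottingham\<close>] by (simp add: v_def)
  then have "G - F = ((G - F) oo u) oo v"
    by (simp add: u0 v flip: compose_assoc)
  also have "(G - F) oo u = (u oo F) - (F oo u)"
    using G by (simp add: fps_compose_sub_distrib u_def)
  finally have *: "G - F = ((u oo F) - (F oo u)) oo v" .
  note w = leading_coeff_commutator[OF F \<open>1 \<le> m\<close> \<open>1 \<le> j\<close>, folded u_def]
  show "fps_X ^ Suc (j + m) dvd G - F"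
    unfolding * by (rule X_power_dvd_compose[OF w(1) v(1)])
  have "(of_nat (p - 1) :: 'a) = - 1"
    using of_nat_CHAR[where 'a = 'a] p prime_gt_0_nat[OF p(1)]
    by (cases p) (simp_all add: eq_neg_iff_add_eq_0 add.commute)
  then show "(G - F) $ Suc (j + m) = of_nat (j + (p - 1) * m) * (F - fps_X) $ Suc m"
    unfolding * leading_coeff_compose[OF w(1) v] w(2) of_nat_add of_nat_mult by simp
qed

text \<open>Conjugation by \<open>u = X + X\<^sup>j\<^sup>+\<^sup>1\<close> with \<open>j = n - k\<close> moves \<open>f\<close>, of depth \<open>k\<close>, at depth \<open>n\<close>, and moves \<open>f\<^sup>p\<close>, of
depth \<open>m = p k + k mod p\<close>, at depth \<open>j + m\<close>. Since \<open>m\<close> and \<open>k\<close> are congruent modulo \<open>p\<close>, both leading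
coefficients are nonzero under the single condition that \<open>p\<close> does not divide \<open>n - 2 k\<close>.\<close>

lemma ex_sharp_pair_conjugate:
  fixes p k n :: nat
  assumes p: "prime p" "CHAR('a::comm_ring_1) = p" and k: "1 \<le> k" "k < n" "\<not> p dvd k"
    and n: "\<not> p dvd n + (p - 2) * k"
  obtains f g :: "'a::comm_ring_1 fps" where "fps_X ^ Suc k dvd f - fps_X" "(f - fps_X) $ Suc k = 1"
    "fps_X ^ Suc n dvd g - f" "(g - f) $ Suc n \<noteq> 0"
    "(g [^]\<^bsub>nottingham\<^esub> p - f [^]\<^bsub>nottingham\<^esub> p) $ Suc (n + (p - 1) * k + k mod p) \<noteq> 0"
proof -
  interpret group "nottingham :: 'a fps monoid"
    by (rule group_nottingham)
  let ?k0 = "k mod p"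
  obtain q where q: "p = Suc (Suc q)"
    using prime_ge_2_nat[OF p(1)] by (metis add_2_eq_Suc le_Suc_ex)
  have k0: "?k0 < p" "0 < ?k0"
    using k q by (simp_all add: mod_greater_zero_iff_not_dvd)
  have dvd: "p dvd k + (p - 2) * k + ?k0"
    using dvd_pred_mult_add_mod[of p k] by (simp add: q)
  define m where "m = p * k + ?k0"
  have m: "m = k + (p - 1) * k + ?k0"
    by (simp add: m_def q)
  \<comment> \<open>For \<open>n = k\<close> the other series is \<open>X\<close>, so \<open>f\<^sup>p\<close> has depth exactly \<open>m\<close>.\<close>
  obtain f :: "'a fps" where f: "fps_X ^ Suc k dvd f - fps_X" "(f - fps_X) $ Suc k = 1"
    and nz: "(fps_X [^]\<^bsub>nottingham\<^esub> p - f [^]\<^bsub>nottingham\<^esub> p) $ Suc m \<noteq> 0"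
    and Xf: "fps_X ^ Suc k dvd fps_X - f"
  proof (rule ex_sharp_pair_below[OF p k(1), of "k + ?k0" k])
    show "(p dvd k) \<noteq> (p dvd k + ?k0 + (p - 2) * k)"
      using dvd k(3) by (simp add: add_ac)
  qed (use k0 in \<open>auto simp: m add_ac intro: that simp del: power_Suc X_nat_pow\<close>)
  let ?F = "f [^]\<^bsub>nottingham\<^esub> p"
  have "depth_excess p k k = ?k0"
    using depth_excess_eq_min[OF p(1) k(3) k0(1) dvd] by simp
  then have "fps_X ^ Suc m dvd fps_X - ?F"
    using power_prime_diff_dvd_excess[OF p k(1) order_refl f(1) Xf] by (simp add: m del: power_Suc)
  then have F: "fps_X ^ Suc m dvd ?F - fps_X"
    by (metis dvd_minus_iff minus_diff_eq)
  define j where "j = n - k"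
  define u :: "'a fps" where "u = fps_X + fps_X ^ Suc j"
  have j: "1 \<le> j" and m1: "1 \<le> m"
    using k k0 by (simp_all add: j_def m_def)
  have fc: "f \<in> carrier nottingham"
    by (rule carrier_of_dvd[OF f(1) k(1)])
  have uc: "u \<in> carrier nottingham"
    using j by (intro carrier_of_dvd[of j]) (simp_all add: u_def)
  define g where "g = u \<otimes>\<^bsub>nottingham\<^esub> f \<otimes>\<^bsub>nottingham\<^esub> inv\<^bsub>nottingham\<^esub> u"
  have gc: "g \<in> carrier nottingham"
    unfolding g_def using fc uc by (intro m_closed inv_closed)
  have gu: "g \<otimes>\<^bsub>nottingham\<^esub> u = u \<otimes>\<^bsub>nottingham\<^esub> f"
    unfolding g_def using fc uc by (simp only: m_assoc l_inv r_one m_closed inv_closed)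
  have gu_pow: "(g [^]\<^bsub>nottingham\<^esub> i) \<otimes>\<^bsub>nottingham\<^esub> u = u \<otimes>\<^bsub>nottingham\<^esub> (f [^]\<^bsub>nottingham\<^esub> i)" for i :: nat
  proof (induction i)
    case (Suc i)
    have "(g [^]\<^bsub>nottingham\<^esub> Suc i) \<otimes>\<^bsub>nottingham\<^esub> u
        = (g [^]\<^bsub>nottingham\<^esub> i) \<otimes>\<^bsub>nottingham\<^esub> (u \<otimes>\<^bsub>nottingham\<^esub> f)"
      using gc uc by (simp only: nat_pow_Suc m_assoc nat_pow_closed flip: gu)
    also have "\<dots> = u \<otimes>\<^bsub>nottingham\<^esub> (f [^]\<^bsub>nottingham\<^esub> Suc i)"
      using gc uc fc by (simp only: Suc m_assoc nat_pow_closed nat_pow_Suc flip: m_assoc)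
    finally show ?case .
  qed (use uc in \<open>simp only: nat_pow_0 l_one r_one\<close>)
  have g0: "g $ 0 = 0" and gp0: "(g [^]\<^bsub>nottingham\<^esub> p) $ 0 = 0"
    using gc nat_pow_closed[OF gc, of p] by (simp_all only: nottingham_carrier_iff)
  note c1 = conjugate_minus[OF p f(1) k(1) j gu[unfolded u_def nottingham_mult] g0]
  note c2 = conjugate_minus[OF p F m1 j gu_pow[unfolded u_def nottingham_mult] gp0]
  have jk: "j + k = n" "j + m = n + (p - 1) * k + ?k0" "j + (p - 1) * k = n + (p - 2) * k"
    using k by (simp_all add: j_def m q)
  have "j + r * m + p * (r * (k div p)) = (j + r * k) + p * (r * k)" for r
  proof -
    have "j + r * m + p * (r * (k div p)) = j + r * (p * k) + r * (?k0 + p * (k div p))"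
      by (simp only: m_def distrib_left mult.left_commute add.assoc)
    also have "?k0 + p * (k div p) = k"
      by simp
    finally show ?thesis
      by (simp only: mult.left_commute add_ac)
  qed
  from this[of "p - 1"] have "j + (p - 1) * m + p * ((p - 1) * (k div p))
      = n + (p - 2) * k + p * ((p - 1) * k)"
    by (simp only: jk(3))
  then have nd: "\<not> p dvd j + (p - 1) * m"
    using n by (metis dvd_add_left_iff dvd_triv_left)
  show thesis
  proof (rule that[OF f])
    show "fps_X ^ Suc n dvd g - f"
      using c1(1) by (simp only: jk)
    show "(g - f) $ Suc n \<noteq> 0"
      using c1(2) n p(2) of_nat_eq_0_iff_char_dvd[where 'a = 'a] unfolding jk f(2)
      by (simp del: of_nat_add of_nat_mult fps_sub_nth)
    have "(?F - fps_X) $ Suc m \<noteq> 0"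
      using nz by simp
    then show "(g [^]\<^bsub>nottingham\<^esub> p - f [^]\<^bsub>nottingham\<^esub> p) $ Suc (n + (p - 1) * k + ?k0) \<noteq> 0"
      using c2(2) of_nat_mult_eq_0_cancel[OF p _ nd] unfolding jk(2) by metis
  qed
qed

text \<open>The case distinction follows the delays in the lower bound. Apart from \<open>n = k\<close> with \<open>p\<close> dividing \<open>k\<close>,
either the coefficient computed in \<open>leading_coeff_power_prime_diff\<close> is nonzero for \<open>n\<close> or for \<open>n\<close>
increased by the excess, or the excess is \<open>k mod p\<close> and conjugation applies.\<close>

lemma ex_sharp_pair:
  fixes p k n :: nat
  assumes p: "prime p" "CHAR('a::comm_ring_1) = p" and k: "1 \<le> k" "k \<le> n"
  obtains f g :: "'a::comm_ring_1 fps" where "fps_X ^ Suc k dvd f - fps_X" "(f - fps_X) $ Suc k = 1"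
    "fps_X ^ Suc n dvd g - f" "(g - f) $ Suc n \<noteq> 0"
    "(g [^]\<^bsub>nottingham\<^esub> p - f [^]\<^bsub>nottingham\<^esub> p) $ Suc (n + (p - 1) * k + depth_excess p k n) \<noteq> 0"
proof -
  let ?e = "depth_excess p k n"
  have one: "(1 :: 'a) \<noteq> 0"
    by (rule char_prime_one_neq_zero[OF p])
  define f0 :: "'a fps" where "f0 = fps_X + fps_X ^ Suc k"
  have f0: "fps_X ^ Suc k dvd f0 - fps_X" "(f0 - fps_X) $ Suc k = 1"
    by (simp_all add: f0_def fps_X_power_nth del: power_Suc)
  obtain i where i: "i < p" "p dvd n + (p - 2) * k + i"
    using ex_residue[OF prime_gt_0_nat[OF p(1)]] .
  have p2: "p \<ge> 2"
    by (rule prime_ge_2_nat[OF p(1)])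
  \<comment> \<open>For \<open>p\<close> not dividing \<open>k\<close> the excess is the smaller of \<open>i\<close> and \<open>k mod p\<close>, and \<open>n + i\<close> is congruent to
  \<open>2 k\<close>; so the last three cases correspond to \<open>i = 0\<close>, \<open>0 < i \<le> k mod p\<close> and \<open>k mod p < i\<close>.\<close>
  consider (equal) "p dvd k" "n = k"
    | (leading) "?e = 0" "k < n" "(p dvd k) \<noteq> (p dvd n + (p - 2) * k)"
    | (below) "0 < ?e" "k < n + ?e" "(p dvd k) \<noteq> (p dvd n + ?e + (p - 2) * k)"
    | (conj) "\<not> p dvd k" "k < n" "\<not> p dvd n + (p - 2) * k" "?e = k mod p"
  proof (cases "p dvd k")
    case True
    have *: "p dvd m + (p - 2) * k \<longleftrightarrow> p dvd m" for m
      using True by (simp add: dvd_add_left_iff)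
    have "\<not> p dvd Suc n" if "p dvd n"
      using that p2 by (metis Suc_eq_plus1 dvd_add_right_iff nat_dvd_1_iff_1 numeral_le_one_iff semiring_norm(69))
    then show thesis
      using True k depth_excess_dvd[OF True, of n] equal leading below *[of n] *[of "Suc n"]
      by (cases "n = k"; cases "p dvd n") simp_all
  next
    case False
    note e = depth_excess_eq_min[OF p(1) False i]
    have "p dvd k + (p - 2) * k + k mod p"
    proof -
      obtain q where "p = Suc (Suc q)"
        using p2 by (metis add_2_eq_Suc le_Suc_ex)
      then show ?thesis
        using dvd_pred_mult_add_mod[of p k] by simp
    qed
    then have nk: "i = k mod p" if "n = k"
      using residue_unique[OF i(1) _ i(2), of "k mod p"] that p2 by simp
    have k0: "0 < k mod p"
      using False by (simp add: mod_greater_zero_iff_not_dvd)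
    consider "i = 0" | "0 < i" "i \<le> k mod p" | "k mod p < i"
      by linarith
    then show thesis
    proof cases
      case 1
      then have "k < n"
        using nk k0 k by (cases "n = k") auto
      then show thesis
        using leading False e i 1 by simp
    next
      case 2
      then show thesis
        using below False e i k by (simp add: add_ac)
    next
      case 3
      have "\<not> p dvd n + (p - 2) * k"
        using residue_unique[OF i(1) _ i(2), of 0] 3 p2 by auto
      then show thesis
        using conj False e 3 nk k by (cases "n = k") auto
    qed
  qed
  then show thesis
  proof cases
    case equal
    have "(f0 [^]\<^bsub>nottingham\<^esub> p - fps_X) $ Suc (p * k) = 1"
      using leading_coeff_power_prime[OF p f0(1) equal(1) k(1)] f0(2) by simp
    moreover have "p * k = n + (p - 1) * k + ?e"
      using equal p2 depth_excess_dvd[OF equal(1), of n] by (cases p) simp_all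
    ultimately have "(fps_X [^]\<^bsub>nottingham\<^esub> p - f0 [^]\<^bsub>nottingham\<^esub> p) $ Suc (n + (p - 1) * k + ?e) = - 1"
      by (metis X_nat_pow fps_neg_nth minus_diff_eq)
    then show thesis
      using one equal(2) by (intro that[OF f0, of fps_X]) (simp_all add: f0_def fps_X_power_nth del: power_Suc)
  next
    case leading
    define g where "g = f0 + fps_X ^ Suc n"
    have g: "fps_X ^ Suc n dvd g - f0" "(g - f0) $ Suc n = 1"
      by (simp_all add: g_def fps_X_power_nth del: power_Suc)
    have "(g [^]\<^bsub>nottingham\<^esub> p - f0 [^]\<^bsub>nottingham\<^esub> p) $ Suc (n + (p - 1) * k)
        = of_bool (p dvd k) - of_bool (p dvd n + (p - 2) * k)"
      using leading_coeff_power_prime_diff[OF p f0(1) g(1) k(1) leading(2)] f0(2) g(2) by simp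
    also have "\<dots> \<noteq> 0"
      using leading(3) one by (auto simp: of_bool_def)
    finally show thesis
      using leading(1) g one by (intro that[OF f0, of g]) simp_all
  next
    case below
    obtain f g :: "'a fps" where "fps_X ^ Suc k dvd f - fps_X" "(f - fps_X) $ Suc k = 1"
      "fps_X ^ Suc n dvd g - f" "(g - f) $ Suc n = - 1"
      "(g [^]\<^bsub>nottingham\<^esub> p - f [^]\<^bsub>nottingham\<^esub> p) $ Suc (n + ?e + (p - 1) * k) \<noteq> 0"
      by (rule ex_sharp_pair_below[OF p k(1) below(2) _ below(3), of n]) (use below(1) in auto)
    then show thesis
      using one by (intro that[of f g]) (simp_all add: add_ac del: power_Suc)
  next
    case conj
    show thesis
      by (rule ex_sharp_pair_conjugate[OF p k(1) conj(2,1,3)]) (use that conj(4) in auto)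
  qed
qed

theorem theorem1:
  fixes p n k :: nat
  assumes "prime p"
    and "CHAR('a::comm_ring_1) = p"
    and "n \<ge> k" and "k \<ge> 1"
  shows
    "(\<forall>f \<in> carrier (nottingham :: 'a fps monoid). \<forall>g \<in> carrier nottingham.
        depth f \<ge> enat k \<and>
        depth (g \<otimes>\<^bsub>nottingham\<^esub> inv\<^bsub>nottingham\<^esub> f) \<ge> enat n \<longrightarrow>
        depth ((g [^]\<^bsub>nottingham\<^esub> p) \<otimes>\<^bsub>nottingham\<^esub> (f [^]\<^bsub>nottingham\<^esub> (- int p)))
          \<ge> enat (n + (p - 1) * k + depth_excess p k n)) \<and>
     (\<exists>f \<in> carrier (nottingham :: 'a fps monoid). \<exists>g \<in> carrier nottingham.
        depth f = enat k \<and>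
        depth (g \<otimes>\<^bsub>nottingham\<^esub> inv\<^bsub>nottingham\<^esub> f) = enat n \<and>
        depth ((g [^]\<^bsub>nottingham\<^esub> p) \<otimes>\<^bsub>nottingham\<^esub> (f [^]\<^bsub>nottingham\<^esub> (- int p)))
          = enat (n + (p - 1) * k + depth_excess p k n))"
proof -
  interpret group "nottingham :: 'a fps monoid"
    by (rule group_nottingham)
  note p = assms(1,2)
  let ?M = "n + (p - 1) * k + depth_excess p k n"
  have n: "n \<ge> 1" and M: "?M \<ge> 1"
    using assms(3,4) by simp_all
  have neg: "f [^]\<^bsub>nottingham\<^esub> (- int p) = inv\<^bsub>nottingham\<^esub> (f [^]\<^bsub>nottingham\<^esub> p)"
    if "f \<in> carrier nottingham" for f :: "'a fps"
    using that by (rule int_pow_neg_int)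
  have a: "enat ?M \<le> depth ((g [^]\<^bsub>nottingham\<^esub> p) \<otimes>\<^bsub>nottingham\<^esub> (f [^]\<^bsub>nottingham\<^esub> (- int p)))"
    if "f \<in> carrier nottingham" "g \<in> carrier nottingham" "depth f \<ge> enat k"
      "depth (g \<otimes>\<^bsub>nottingham\<^esub> inv\<^bsub>nottingham\<^esub> f) \<ge> enat n" for f g :: "'a fps"
  proof -
    have "fps_X ^ Suc k dvd f - fps_X" "fps_X ^ Suc n dvd g - f"
      using that depth_ge_iff[OF that(1) assms(4)] depth_quotient_ge_iff[OF that(1,2) n] by blast+
    then have "fps_X ^ Suc ?M dvd g [^]\<^bsub>nottingham\<^esub> p - f [^]\<^bsub>nottingham\<^esub> p"
      by (rule power_prime_diff_dvd_excess[OF p assms(4,3)])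
    then show ?thesis
      unfolding neg[OF that(1)]
      using depth_quotient_ge_iff[OF nat_pow_closed[OF that(1)] nat_pow_closed[OF that(2)] M] by blast
  qed
  obtain f g :: "'a fps" where f: "fps_X ^ Suc k dvd f - fps_X" "(f - fps_X) $ Suc k = 1"
    and g: "fps_X ^ Suc n dvd g - f" "(g - f) $ Suc n \<noteq> 0"
    and sharp: "(g [^]\<^bsub>nottingham\<^esub> p - f [^]\<^bsub>nottingham\<^esub> p) $ Suc ?M \<noteq> 0"
    by (rule ex_sharp_pair[OF p assms(4,3)])
  have fc: "f \<in> carrier nottingham"
    by (rule carrier_of_dvd[OF f(1) assms(4)])
  have "fps_X ^ Suc k dvd (g - f) + (f - fps_X)"
    using f(1) X_power_dvd_le[OF g(1), of "Suc k"] assms(3) by (intro dvd_add) auto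
  then have gc: "g \<in> carrier nottingham"
    by (intro carrier_of_dvd[OF _ assms(4)]) simp
  have "depth f = enat k"
    using depth_eq_iff[OF fc assms(4)] f char_prime_one_neq_zero[OF p] by auto
  moreover have "depth (g \<otimes>\<^bsub>nottingham\<^esub> inv\<^bsub>nottingham\<^esub> f) = enat n"
    using depth_quotient_eq_iff[OF fc gc n] g by blast
  moreover have "depth ((g [^]\<^bsub>nottingham\<^esub> p) \<otimes>\<^bsub>nottingham\<^esub> (f [^]\<^bsub>nottingham\<^esub> (- int p))) = enat ?M"
    unfolding neg[OF fc]
    using depth_quotient_eq_iff[OF nat_pow_closed[OF fc] nat_pow_closed[OF gc] M] sharp
      power_prime_diff_dvd_excess[OF p assms(4,3) f(1) g(1)] by blast
  ultimately show ?thesis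
    using a fc gc by blast
qed


end
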